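(* Let $p$ be a prime, let $M,N\ge 0$ be integers, and let $S\subset\mathbb{Q}_p$ be a set such that $\check{\mathbf{1}}_S\in\mathcal{D}_N^M$. If $S$ is a scaling set, then $p^N$ many integers are in $p^{M}S\cap[0,p^{M+N}-1]$, i.e. the number of integers $n$ with $0\le n\le p^{M+N}-1$ and $n\in p^MS$ is $p^N$.
   Context: $\mathbb{Q}_p$ is the field of $p$-adic numbers, with norm $|\cdot|_p$ and ring of integers $\mathbb{Z}_p=\{x:|x|_p\le 1\}$. The Haar measure $dx$ is normalized by $\int_{\mathbb{Z}_p}dx=1$. $B_\gamma(c)=\{x:|x-c|_p\le p^\gamma\}$. For $x=\sum_{j\ge\gamma}x_jp^j$ with digits $x_j\in\{0,\dots,p-1\}$, the fractional part is $\{x\}_p=\sum_{j=\gamma}^{-1}x_jp^j$ (and $\{x\}_p=0$ if $x=0$ or $\gamma\ge 0$). $I_p=\{x\in\mathbb{Q}_p:\{x\}_p=x\}$. $\chi_p(x)=e^{2\pi i\{x\}_p}$. The Fourier transform on $L^2(\mathbb{Q}_p)$ is the unitary extension of $\hat f(\xi)=\int_{\mathbb{Q}_p}\chi_p(\xi x)f(x)\,dx$, with inverse $\check f(\xi)=\int_{\mathbb{Q}_p}\chi_p(-\xi x)f(x)\,dx$. For $A\subset\mathbb{Q}_p$, $p^jA=\{p^ja:a\in A\}$, and $\mathbf{1}_A$ is the characteristic function of $A$. $\mathcal{D}_N^M$ is the set of locally constant functions $f:\mathbb{Q}_p\to\mathbb{C}$ that are $p^M$-periodic ($f(x+p^M)=f(x)$)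 and supported on $B_N(0)$. MRA: a collection of closed subspaces $V_j\subset L^2(\mathbb{Q}_p)$, $j\in\mathbb{Z}$, is a multiresolution analysis if (i) $V_j\subset V_{j+1}$ for all $j$; (ii) $\bigcup_jV_j$ is dense in $L^2(\mathbb{Q}_p)$; (iii) $\bigcap_jV_j=\{0\}$; (iv) $f(\cdot)\in V_j\iff f(p^{-1}\cdot)\in V_{j+1}$ for all $j$; (v) there is $\phi\in V_0$, called a scaling function of the MRA, such that $\{\phi(\cdot-a):a\in I_p\}$ is an orthonormal basis of $V_0$. Scaling set: a measurable set $S\subset\mathbb{Q}_p$ is a scaling set if $\check{\mathbf{1}}_S$ is a scaling function of an MRA in $L^2(\mathbb{Q}_p)$.
   Formalization: As stated the claim fails for sets altered on a null set (S = Z_p minus the integers, M = N = 0); the count is proved for the unique set T equal to S almost everywhere whose characteristic function is locally constant, and T = S when 1_S is itself locally constant. *)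

theory Defs
  imports "HOL-Analysis.Analysis" "Berlekamp_Zassenhaus.Finite_Field"
begin

definition padic_val :: "nat \<Rightarrow> rat \<Rightarrow> int" where
  "padic_val p q = (case quotient_of q of (a, b) \<Rightarrow>
     int (multiplicity (int p) a) - int (multiplicity (int p) b))"

definition padic_abs :: "nat \<Rightarrow> rat \<Rightarrow> real" where
  "padic_abs p q = (if q = 0 then 0 else real p powi (- padic_val p q))"

lemma padic_val_divide:
  assumes p: "prime p" and a: "a \<noteq> 0" and b: "b \<noteq> 0"
  shows "padic_val p (of_int a / of_int b) =
    int (multiplicity (int p) a) - int (multiplicity (int p) b)"
proof -
  obtain c d where cd: "quotient_of (of_int a / of_int b :: rat) = (c, d)"
    by (cases "quotient_of (of_int a / of_int b :: rat)") auto
  have d: "d > 0" using quotient_of_denom_pos[OF cd] .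
  have eq: "(of_int a / of_int b :: rat) = of_int c / of_int d" using quotient_of_div[OF cd] .
  have "c \<noteq> 0" using eq a b d by auto
  have "(of_int (a * d) :: rat) = of_int (c * b)" using eq b d by (simp add: field_simps)
  then have "a * d = c * b" by (simp only: of_int_eq_iff)
  then have "multiplicity (int p) (a * d) = multiplicity (int p) (c * b)" by simp
  moreover have "prime_elem (int p)" using p by simp
  ultimately have "multiplicity (int p) a + multiplicity (int p) d
      = multiplicity (int p) c + multiplicity (int p) b"
    using a b d \<open>c \<noteq> 0\<close> by (simp add: prime_elem_multiplicity_mult_distrib)
  then show ?thesis using cd by (simp add: padic_val_def)
qed

lemma rat_as_divide:
  obtains a b :: int where "(q :: rat) = of_int a / of_int b" "b \<noteq> 0"
  by (metis Fract_of_int_quotient Rat_cases less_irrefl)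

lemma padic_abs_divide:
  assumes "prime p" "a \<noteq> 0" "b \<noteq> 0"
  shows "padic_abs p (of_int a / of_int b) =
    real p powi (int (multiplicity (int p) b) - int (multiplicity (int p) a))"
  using assms by (simp add: padic_abs_def padic_val_divide)

lemma padic_abs_0 [simp]: "padic_abs p 0 = 0"
  by (simp add: padic_abs_def)

lemma padic_abs_1 [simp]: "padic_abs p 1 = 1"
  by (simp add: padic_abs_def padic_val_def)

lemma padic_abs_nonneg [simp]: "padic_abs p q \<ge> 0"
  by (simp add: padic_abs_def)

lemma padic_abs_eq_0 [simp]: "prime p \<Longrightarrow> padic_abs p q = 0 \<longleftrightarrow> q = 0"
  by (auto simp: padic_abs_def)

lemma padic_abs_mult:
  assumes "prime p"
  shows "padic_abs p (x * y) = padic_abs p x * padic_abs p y"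
proof (cases "x = 0 \<or> y = 0")
  case False
  obtain a b where x: "x = of_int a / of_int b" "b \<noteq> 0" by (rule rat_as_divide)
  obtain c d where y: "y = of_int c / of_int d" "d \<noteq> 0" by (rule rat_as_divide)
  have nz: "a \<noteq> 0" "c \<noteq> 0" using False x y by auto
  have p0: "real p \<noteq> 0" and pe: "prime_elem (int p)" using assms by auto
  have "padic_abs p (of_int (a * c) / of_int (b * d)) =
     real p powi (int (multiplicity (int p) (b * d)) - int (multiplicity (int p) (a * c)))"
    using nz x y assms by (intro padic_abs_divide) auto
  also have "\<dots> = real p powi ((int (multiplicity (int p) b) - int (multiplicity (int p) a))
      + (int (multiplicity (int p) d) - int (multiplicity (int p) c)))"
    using nz x y pe by (simp add: prime_elem_multiplicity_mult_distrib algebra_simps)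
  also have "\<dots> = padic_abs p x * padic_abs p y"
    using nz x y assms p0 by (simp add: padic_abs_divide power_int_add)
  finally show ?thesis using x y by simp
qed auto

lemma padic_abs_minus [simp]: "padic_abs p (- x) = padic_abs p x"
proof -
  have "quotient_of (- x) = (case quotient_of x of (a, b) \<Rightarrow> (- a, b))"
    by (simp add: rat_uminus_code)
  moreover have "multiplicity (int p) (- a) = multiplicity (int p) a" for a
    by (rule multiplicity_cong) simp
  ultimately show ?thesis by (auto simp: padic_abs_def padic_val_def split: prod.splits)
qed

lemma padic_abs_add:
  assumes "prime p"
  shows "padic_abs p (x + y) \<le> max (padic_abs p x) (padic_abs p y)"
proof (cases "x = 0 \<or> y = 0 \<or> x + y = 0")
  case True
  then show ?thesis by (auto simp: max_def)
next
  case False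
  obtain a b where x: "x = of_int a / of_int b" "b \<noteq> 0" by (rule rat_as_divide)
  obtain c d where y: "y = of_int c / of_int d" "d \<noteq> 0" by (rule rat_as_divide)
  define e where "e = b * d"
  define u where "u = a * d"
  define v where "v = c * b"
  let ?m = "multiplicity (int p)"
  have e: "e \<noteq> 0" using x y by (simp add: e_def)
  have xu: "x = of_int u / of_int e" and yv: "y = of_int v / of_int e"
    using x y by (simp_all add: e_def u_def v_def)
  have xyw: "x + y = of_int (u + v) / of_int e" by (simp add: xu yv add_divide_distrib)
  have nz: "u \<noteq> 0" "v \<noteq> 0" "u + v \<noteq> 0" using False xu yv xyw by auto
  have p1: "real p > 1" using prime_gt_1_nat[OF assms] by simp
  have np: "\<not> is_unit (int p)" using prime_gt_1_nat[OF assms] by simp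
  have "int p ^ min (?m u) (?m v) dvd u + v"
    by (intro dvd_add) (auto intro: multiplicity_dvd')
  then have "min (?m u) (?m v) \<le> ?m (u + v)"
    by (intro multiplicity_geI) (use nz np in auto)
  then consider "?m u \<le> ?m (u + v)" | "?m v \<le> ?m (u + v)" by linarith
  then show ?thesis
  proof cases
    case 1
    then have "padic_abs p (x + y) \<le> padic_abs p x"
      unfolding xyw unfolding xu using assms e nz p1 by (simp add: padic_abs_divide power_int_increasing del: of_int_add)
    then show ?thesis by simp
  next
    case 2
    then have "padic_abs p (x + y) \<le> padic_abs p y"
      unfolding xyw unfolding yv using assms e nz p1 by (simp add: padic_abs_divide power_int_increasing del: of_int_add)
    then show ?thesis by simp
  qed
qed

lemma padic_abs_triangle:
  assumes "prime p"
  shows "padic_abs p (x + y) \<le> padic_abs p x + padic_abs p y"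
  using padic_abs_add[OF assms, of x y] padic_abs_nonneg[of p x] padic_abs_nonneg[of p y]
  by linarith

lemma padic_abs_diff_commute: "padic_abs p (x - y) = padic_abs p (y - x)"
  using padic_abs_minus[of p "x - y"] by simp

lemma padic_abs_triangle3:
  assumes "prime p"
  shows "\<bar>padic_abs p x - padic_abs p y\<bar> \<le> padic_abs p (x - y)"
  using padic_abs_triangle[OF assms, of "x - y" y] padic_abs_triangle[OF assms, of "y - x" x]
    padic_abs_diff_commute[of p x y] by simp

lemma padic_abs_inverse:
  assumes "prime p"
  shows "padic_abs p (inverse x) = inverse (padic_abs p x)"
proof (cases "x = 0")
  case False
  then have "padic_abs p x * padic_abs p (inverse x) = 1"
    by (simp flip: padic_abs_mult[OF assms])
  then show ?thesis by (simp add: inverse_unique)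
qed auto

definition padic_Cauchy :: "nat \<Rightarrow> (nat \<Rightarrow> rat) \<Rightarrow> bool" where
  "padic_Cauchy p X \<longleftrightarrow> (\<forall>e>0. \<exists>k. \<forall>m\<ge>k. \<forall>n\<ge>k. padic_abs p (X m - X n) < e)"

definition padic_null :: "nat \<Rightarrow> (nat \<Rightarrow> rat) \<Rightarrow> bool" where
  "padic_null p X \<longleftrightarrow> (\<lambda>n. padic_abs p (X n)) \<longlonglongrightarrow> 0"

lemma padic_Cauchy_const [simp]: "padic_Cauchy p (\<lambda>_. c)"
  by (simp add: padic_Cauchy_def)

lemma padic_null_0 [simp]: "padic_null p (\<lambda>_. 0)"
  by (simp add: padic_null_def)

lemma padic_null_bound:
  assumes "\<And>n. padic_abs p (X n) \<le> f n" "f \<longlonglongrightarrow> 0"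
  shows "padic_null p X"
  unfolding padic_null_def
  by (rule tendsto_sandwich[OF _ _ tendsto_const assms(2)]) (use assms(1) in auto)

lemma padic_null_add:
  assumes "prime p" "padic_null p X" "padic_null p Y"
  shows "padic_null p (\<lambda>n. X n + Y n)"
  using padic_abs_triangle[OF assms(1)] tendsto_add[OF assms(2,3)[unfolded padic_null_def]]
  by (intro padic_null_bound[where f = "\<lambda>n. padic_abs p (X n) + padic_abs p (Y n)"]) auto

lemma padic_null_minus: "padic_null p X \<Longrightarrow> padic_null p (\<lambda>n. - X n)"
  by (simp add: padic_null_def)

lemma padic_null_minus_commute: "padic_null p (\<lambda>n. X n - Y n) \<Longrightarrow> padic_null p (\<lambda>n. Y n - X n)"
  using padic_null_minus[of p "\<lambda>n. X n - Y n"] by simp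

lemma padic_Cauchy_add:
  assumes p: "prime p" and X: "padic_Cauchy p X" and Y: "padic_Cauchy p Y"
  shows "padic_Cauchy p (\<lambda>n. X n + Y n)"
  unfolding padic_Cauchy_def
proof (intro allI impI)
  fix e :: real assume e: "e > 0"
  obtain k where k: "\<And>m n. m \<ge> k \<Longrightarrow> n \<ge> k \<Longrightarrow> padic_abs p (X m - X n) < e"
    using X e unfolding padic_Cauchy_def by blast
  obtain l where l: "\<And>m n. m \<ge> l \<Longrightarrow> n \<ge> l \<Longrightarrow> padic_abs p (Y m - Y n) < e"
    using Y e unfolding padic_Cauchy_def by blast
  have "padic_abs p (X m + Y m - (X n + Y n)) < e" if "m \<ge> max k l" "n \<ge> max k l" for m n
    using padic_abs_add[OF p, of "X m - X n" "Y m - Y n"] k[of m n] l[of m n] that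
    by (simp add: algebra_simps)
  then show "\<exists>k. \<forall>m\<ge>k. \<forall>n\<ge>k. padic_abs p (X m + Y m - (X n + Y n)) < e" by blast
qed

lemma padic_Cauchy_minus:
  assumes "padic_Cauchy p X"
  shows "padic_Cauchy p (\<lambda>n. - X n)"
proof -
  have "padic_abs p (- X m - - X n) = padic_abs p (X m - X n)" for m n
    using padic_abs_minus[of p "X m - X n"] by simp
  then show ?thesis using assms unfolding padic_Cauchy_def by simp
qed

lemma padic_Cauchy_abs_convergent:
  assumes p: "prime p" and X: "padic_Cauchy p X"
  shows "convergent (\<lambda>n. padic_abs p (X n))"
proof -
  have "Cauchy (\<lambda>n. padic_abs p (X n))"
    unfolding Cauchy_def dist_real_def
    using X padic_abs_triangle3[OF p] unfolding padic_Cauchy_def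
    by (meson le_less_trans)
  then show ?thesis by (rule Cauchy_convergent)
qed

lemma padic_Cauchy_bounded:
  assumes p: "prime p" and X: "padic_Cauchy p X"
  obtains B where "B > 0" "\<And>n. padic_abs p (X n) \<le> B"
proof -
  have "Bseq (\<lambda>n. padic_abs p (X n))"
    by (rule convergent_imp_Bseq[OF padic_Cauchy_abs_convergent[OF p X]])
  then show ?thesis using that by (auto elim!: BseqE)
qed

lemma padic_null_mult_bounded:
  assumes p: "prime p" and X: "padic_Cauchy p X" and Y: "padic_null p Y"
  shows "padic_null p (\<lambda>n. X n * Y n)"
proof -
  obtain B where B: "B > 0" "\<And>n. padic_abs p (X n) \<le> B" using padic_Cauchy_bounded[OF p X] by blast
  show ?thesis
  proof (rule padic_null_bound)
    show "padic_abs p (X n * Y n) \<le> B * padic_abs p (Y n)" for n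
      using B by (simp add: padic_abs_mult[OF p] mult_right_mono)
    show "(\<lambda>n. B * padic_abs p (Y n)) \<longlonglongrightarrow> 0"
      using Y unfolding padic_null_def by (rule tendsto_mult_right_zero)
  qed
qed

lemma padic_Cauchy_mult:
  assumes p: "prime p" and X: "padic_Cauchy p X" and Y: "padic_Cauchy p Y"
  shows "padic_Cauchy p (\<lambda>n. X n * Y n)"
  unfolding padic_Cauchy_def
proof (intro allI impI)
  fix e :: real assume e: "e > 0"
  obtain A where A: "A > 0" "\<And>n. padic_abs p (X n) \<le> A" using padic_Cauchy_bounded[OF p X] by blast
  obtain B where B: "B > 0" "\<And>n. padic_abs p (Y n) \<le> B" using padic_Cauchy_bounded[OF p Y] by blast
  obtain k where k: "\<And>m n. m \<ge> k \<Longrightarrow> n \<ge> k \<Longrightarrow> padic_abs p (X m - X n) < e / B"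
    using X e B unfolding padic_Cauchy_def by (meson divide_pos_pos)
  obtain l where l: "\<And>m n. m \<ge> l \<Longrightarrow> n \<ge> l \<Longrightarrow> padic_abs p (Y m - Y n) < e / A"
    using Y e A unfolding padic_Cauchy_def by (meson divide_pos_pos)
  have "padic_abs p (X m * Y m - X n * Y n) < e" if "m \<ge> max k l" "n \<ge> max k l" for m n
  proof -
    have 1: "padic_abs p (X m * (Y m - Y n)) < e"
    proof -
      have "padic_abs p (X m * (Y m - Y n)) \<le> A * padic_abs p (Y m - Y n)"
        using A by (simp add: padic_abs_mult[OF p] mult_right_mono)
      also have "\<dots> < A * (e / A)" using A l[of m n] that by (intro mult_strict_left_mono) auto
      finally show ?thesis using A by simp
    qed
    have 2: "padic_abs p (Y n * (X m - X n)) < e"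
    proof -
      have "padic_abs p (Y n * (X m - X n)) \<le> B * padic_abs p (X m - X n)"
        using B by (simp add: padic_abs_mult[OF p] mult_right_mono)
      also have "\<dots> < B * (e / B)" using B k[of m n] that by (intro mult_strict_left_mono) auto
      finally show ?thesis using B by simp
    qed
    have "X m * Y m - X n * Y n = X m * (Y m - Y n) + Y n * (X m - X n)"
      by (simp add: algebra_simps)
    then show ?thesis
      using padic_abs_add[OF p, of "X m * (Y m - Y n)" "Y n * (X m - X n)"] 1 2 by simp
  qed
  then show "\<exists>k. \<forall>m\<ge>k. \<forall>n\<ge>k. padic_abs p (X m * Y m - X n * Y n) < e" by blast
qed

lemma padic_Cauchy_not_null:
  assumes p: "prime p" and X: "padic_Cauchy p X" and nX: "\<not> padic_null p X"
  obtains b k where "b > 0" "\<And>n. n \<ge> k \<Longrightarrow> padic_abs p (X n) > b"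
proof -
  obtain L where L: "(\<lambda>n. padic_abs p (X n)) \<longlonglongrightarrow> L"
    using padic_Cauchy_abs_convergent[OF p X] by (auto simp: convergent_def)
  have "L \<ge> 0" by (rule tendsto_lowerbound[OF L]) auto
  moreover have "L \<noteq> 0" using nX L by (auto simp: padic_null_def)
  ultimately have "L > 0" by simp
  then have "eventually (\<lambda>n. padic_abs p (X n) > L / 2) sequentially"
    by (intro order_tendstoD(1)[OF L]) auto
  then obtain k where "\<And>n. n \<ge> k \<Longrightarrow> padic_abs p (X n) > L / 2"
    by (auto simp: eventually_sequentially)
  then show ?thesis using that \<open>L > 0\<close> by (metis half_gt_zero)
qed

lemma padic_Cauchy_inverse:
  assumes p: "prime p" and X: "padic_Cauchy p X" and nX: "\<not> padic_null p X"
  shows "padic_Cauchy p (\<lambda>n. inverse (X n))"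
  unfolding padic_Cauchy_def
proof (intro allI impI)
  fix e :: real assume e: "e > 0"
  obtain b k where b: "b > 0" "\<And>n. n \<ge> k \<Longrightarrow> padic_abs p (X n) > b"
    using padic_Cauchy_not_null[OF assms] by blast
  obtain l where l: "\<And>m n. m \<ge> l \<Longrightarrow> n \<ge> l \<Longrightarrow> padic_abs p (X m - X n) < e * (b * b)"
    using X e b unfolding padic_Cauchy_def by (meson mult_pos_pos)
  have "padic_abs p (inverse (X m) - inverse (X n)) < e" if mn: "m \<ge> max k l" "n \<ge> max k l" for m n
  proof -
    have bm: "padic_abs p (X m) > b" and bn: "padic_abs p (X n) > b" using b mn by auto
    then have "X m \<noteq> 0" "X n \<noteq> 0" using b by auto
    then have "inverse (X m) - inverse (X n) = inverse (X m) * inverse (X n) * (X n - X m)"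
      by (simp add: field_simps)
    then have "padic_abs p (inverse (X m) - inverse (X n)) =
        padic_abs p (X n - X m) / (padic_abs p (X m) * padic_abs p (X n))"
      by (simp only: padic_abs_mult[OF p] padic_abs_inverse[OF p]) (simp add: divide_inverse)
    also have "\<dots> \<le> padic_abs p (X n - X m) / (b * b)"
      using b bm bn by (intro divide_left_mono mult_mono mult_pos_pos) auto
    also have "\<dots> < e" using l[of n m] mn b by (simp add: field_simps)
    finally show ?thesis .
  qed
  then show "\<exists>k. \<forall>m\<ge>k. \<forall>n\<ge>k. padic_abs p (inverse (X m) - inverse (X n)) < e" by blast
qed

lemma padic_null_eventually_eq:
  assumes "padic_null p X" "\<And>n. n \<ge> k \<Longrightarrow> X n = Y n"
  shows "padic_null p Y"
  using assms(1) unfolding padic_null_def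
  by (rule Lim_transform_eventually) (auto simp: eventually_sequentially assms(2) intro!: exI[of _ k])

lemma padic_null_inverse_mult:
  assumes p: "prime p" and X: "padic_Cauchy p X" and nX: "\<not> padic_null p X"
  shows "padic_null p (\<lambda>n. inverse (X n) * X n - 1)"
proof -
  obtain b k where b: "b > 0" "\<And>n. n \<ge> k \<Longrightarrow> padic_abs p (X n) > b"
    using padic_Cauchy_not_null[OF assms] by blast
  have "0 = inverse (X n) * X n - 1" if "n \<ge> k" for n
    using b that by (cases "X n = 0") fastforce+
  then show ?thesis by (intro padic_null_eventually_eq[OF padic_null_0])
qed

typedef ('p::prime_card) padic_seq = "{X. padic_Cauchy CARD('p) X}"
  morphisms seq_nth Abs_padic_seq
  by (rule exI[of _ "\<lambda>_. 0"]) simp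

setup_lifting type_definition_padic_seq

lemma Cauchy_seq_nth: "padic_Cauchy CARD('p) (seq_nth X)" for X :: "'p::prime_card padic_seq"
  using seq_nth by auto

instantiation padic_seq :: (prime_card) comm_ring_1
begin

lift_definition zero_padic_seq :: "'a padic_seq" is "\<lambda>_. 0" by simp
lift_definition one_padic_seq :: "'a padic_seq" is "\<lambda>_. 1" by simp
lift_definition plus_padic_seq :: "'a padic_seq \<Rightarrow> 'a padic_seq \<Rightarrow> 'a padic_seq"
  is "\<lambda>X Y n. X n + Y n" by (rule padic_Cauchy_add[OF prime_card])
lift_definition uminus_padic_seq :: "'a padic_seq \<Rightarrow> 'a padic_seq"
  is "\<lambda>X n. - X n" by (rule padic_Cauchy_minus)
lift_definition minus_padic_seq :: "'a padic_seq \<Rightarrow> 'a padic_seq \<Rightarrow> 'a padic_seq"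
  is "\<lambda>X Y n. X n - Y n"
  using padic_Cauchy_add[OF prime_card[where 'a = 'a] _ padic_Cauchy_minus] by simp
lift_definition times_padic_seq :: "'a padic_seq \<Rightarrow> 'a padic_seq \<Rightarrow> 'a padic_seq"
  is "\<lambda>X Y n. X n * Y n" by (rule padic_Cauchy_mult[OF prime_card])

instance
proof
  show "(0 :: 'a padic_seq) \<noteq> 1" by transfer (simp add: fun_eq_iff)
qed (transfer; simp add: algebra_simps)+

end

definition null_seq :: "'p::prime_card padic_seq \<Rightarrow> bool" where
  "null_seq X \<longleftrightarrow> padic_null CARD('p) (seq_nth X)"

definition padic_equiv :: "'p::prime_card padic_seq \<Rightarrow> 'p padic_seq \<Rightarrow> bool" where
  "padic_equiv X Y \<longleftrightarrow> null_seq (X - Y)"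

lemma null_seq_0 [simp]: "null_seq 0"
  by (simp add: null_seq_def zero_padic_seq.rep_eq)

lemma null_seq_add: "null_seq X \<Longrightarrow> null_seq Y \<Longrightarrow> null_seq (X + Y)"
  by (simp add: null_seq_def plus_padic_seq.rep_eq padic_null_add prime_card)

lemma null_seq_minus: "null_seq X \<Longrightarrow> null_seq (- X)"
  by (simp add: null_seq_def uminus_padic_seq.rep_eq padic_null_minus)

lemma null_seq_mult: "null_seq Y \<Longrightarrow> null_seq (X * Y)"
  by (simp add: null_seq_def times_padic_seq.rep_eq padic_null_mult_bounded prime_card Cauchy_seq_nth)

lemma equivp_padic_equiv: "equivp padic_equiv"
proof (rule equivpI)
  show "reflp padic_equiv" by (simp add: reflp_def padic_equiv_def)
  show "symp padic_equiv"
    unfolding symp_def padic_equiv_def by (metis minus_diff_eq null_seq_minus)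
  show "transp padic_equiv"
    unfolding transp_def padic_equiv_def by (metis diff_add_cancel add_diff_eq null_seq_add)
qed

text \<open>The prime is carried by the index type: \<open>'p padic\<close> is the field of p-adic numbers for
  \<open>p = CARD('p)\<close>, i.e. Cauchy sequences of rationals modulo null sequences.\<close>

quotient_type (overloaded) 'p padic = "'p::prime_card padic_seq" / padic_equiv
  by (rule equivp_padic_equiv)

lift_definition inverse_seq :: "'p::prime_card padic_seq \<Rightarrow> 'p padic_seq"
  is "\<lambda>X. if padic_null CARD('p) X then (\<lambda>_. 0) else (\<lambda>n. inverse (X n))"
  by (simp add: padic_Cauchy_inverse prime_card)

lemma inverse_seq_null: "null_seq X \<Longrightarrow> inverse_seq X = 0"
  unfolding null_seq_def by transfer simp

lemma inverse_seq_mult: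
  "\<not> null_seq X \<Longrightarrow> padic_equiv (inverse_seq X * X) 1"
  unfolding null_seq_def padic_equiv_def
  by transfer (simp add: padic_null_inverse_mult prime_card)

instantiation padic :: (prime_card) field
begin

lift_definition zero_padic :: "'a padic" is 0 .
lift_definition one_padic :: "'a padic" is 1 .

lift_definition plus_padic :: "'a padic \<Rightarrow> 'a padic \<Rightarrow> 'a padic" is "(+)"
  unfolding padic_equiv_def by (simp add: add_diff_add null_seq_add)

lift_definition uminus_padic :: "'a padic \<Rightarrow> 'a padic" is uminus
  unfolding padic_equiv_def using null_seq_minus by fastforce

lift_definition minus_padic :: "'a padic \<Rightarrow> 'a padic \<Rightarrow> 'a padic" is "(-)"
proof -
  fix X X' Y Y' :: "'a padic_seq"
  assume "padic_equiv X X'" "padic_equiv Y Y'"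
  then have "null_seq ((X - X') + - (Y - Y'))"
    unfolding padic_equiv_def by (intro null_seq_add null_seq_minus)
  then show "padic_equiv (X - Y) (X' - Y')" by (simp add: padic_equiv_def algebra_simps)
qed

lift_definition times_padic :: "'a padic \<Rightarrow> 'a padic \<Rightarrow> 'a padic" is "(*)"
proof -
  fix X X' Y Y' :: "'a padic_seq"
  assume "padic_equiv X X'" "padic_equiv Y Y'"
  then have "null_seq (Y * (X - X') + X' * (Y - Y'))"
    unfolding padic_equiv_def by (intro null_seq_add null_seq_mult)
  then show "padic_equiv (X * Y) (X' * Y')" by (simp add: padic_equiv_def algebra_simps)
qed

lift_definition inverse_padic :: "'a padic \<Rightarrow> 'a padic" is inverse_seq
proof -
  fix X Y :: "'a padic_seq"
  assume XY: "padic_equiv X Y"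
  then have iff: "null_seq X \<longleftrightarrow> null_seq Y"
    unfolding padic_equiv_def using null_seq_add[of "X - Y" Y] null_seq_add[of "- (X - Y)" X]
      null_seq_minus[of "X - Y"] by auto
  show "padic_equiv (inverse_seq X) (inverse_seq Y)"
  proof (cases "null_seq X")
    case True
    then show ?thesis using iff by (simp add: inverse_seq_null padic_equiv_def)
  next
    case False
    let ?x = "inverse_seq X" and ?y = "inverse_seq Y"
    have "null_seq (?x * X - 1)" "null_seq (?y * Y - 1)" "null_seq (X - Y)"
      using inverse_seq_mult[of X] inverse_seq_mult[of Y] False iff XY
      by (auto simp: padic_equiv_def)
    then have "null_seq (?y * (?x * X - 1) + - (?x * (?y * Y - 1)) + - (?x * ?y * (X - Y)))"
      by (intro null_seq_add null_seq_minus null_seq_mult)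
    also have "?y * (?x * X - 1) + - (?x * (?y * Y - 1)) + - (?x * ?y * (X - Y)) = ?x - ?y"
      by (simp add: algebra_simps)
    finally show ?thesis by (simp add: padic_equiv_def)
  qed
qed

definition divide_padic :: "'a padic \<Rightarrow> 'a padic \<Rightarrow> 'a padic" where
  "divide_padic x y = x * inverse y"

instance
proof
  fix a b c :: "'a padic"
  show "a + b + c = a + (b + c)" by transfer (simp add: padic_equiv_def algebra_simps)
  show "a + b = b + a" by transfer (simp add: padic_equiv_def algebra_simps)
  show "0 + a = a" by transfer (simp add: padic_equiv_def)
  show "- a + a = 0" by transfer (simp add: padic_equiv_def)
  show "a - b = a + - b" by transfer (simp add: padic_equiv_def)
  show "a * b * c = a * (b * c)" by transfer (simp add: padic_equiv_def algebra_simps)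
  show "a * b = b * a" by transfer (simp add: padic_equiv_def algebra_simps)
  show "1 * a = a" by transfer (simp add: padic_equiv_def)
  show "(a + b) * c = a * c + b * c" by transfer (simp add: padic_equiv_def algebra_simps)
  show "(0 :: 'a padic) \<noteq> 1"
    by transfer (simp add: padic_equiv_def null_seq_def padic_null_def tendsto_const_iff
        uminus_padic_seq.rep_eq one_padic_seq.rep_eq)
  show "a \<noteq> 0 \<Longrightarrow> inverse a * a = 1"
    by transfer (rule inverse_seq_mult, simp add: padic_equiv_def)
  show "a div b = a * inverse b" by (rule divide_padic_def)
  show "inverse (0 :: 'a padic) = 0" by transfer (simp add: padic_equiv_def inverse_seq_null)
qed

end

lemma of_nat_padic_seq: "seq_nth (of_nat n :: 'p::prime_card padic_seq) = (\<lambda>_. of_nat n)"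
  by (induction n) (simp_all add: zero_padic_seq.rep_eq one_padic_seq.rep_eq plus_padic_seq.rep_eq)

lemma of_nat_padic: "(of_nat n :: 'p::prime_card padic) = abs_padic (of_nat n)"
  by (induction n) (simp_all add: zero_padic_def one_padic_def plus_padic.abs_eq)

instance padic :: (prime_card) field_char_0
proof
  show "inj (of_nat :: nat \<Rightarrow> 'a padic)"
  proof (rule injI)
    fix m n assume "(of_nat m :: 'a padic) = of_nat n"
    then have "padic_equiv (of_nat m :: 'a padic_seq) (of_nat n)"
      by (simp add: of_nat_padic padic.abs_eq_iff)
    then have "padic_abs CARD('a) (of_nat m - of_nat n) = 0"
      by (simp add: padic_equiv_def null_seq_def minus_padic_seq.rep_eq of_nat_padic_seq
          padic_null_def tendsto_const_iff)
    then show "m = n" by (simp add: prime_card)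
  qed
qed

lift_definition seq_norm :: "'p::prime_card padic_seq \<Rightarrow> real"
  is "\<lambda>X. lim (\<lambda>n. padic_abs CARD('p) (X n))" .

lemma seq_norm_tendsto:
  "(\<lambda>n. padic_abs CARD('p) (seq_nth X n)) \<longlonglongrightarrow> seq_norm X" for X :: "'p::prime_card padic_seq"
  using padic_Cauchy_abs_convergent[OF prime_card Cauchy_seq_nth[of X]]
  by (simp add: seq_norm.rep_eq convergent_LIMSEQ_iff)

lemma seq_norm_eq_0: "seq_norm X = 0 \<longleftrightarrow> null_seq X"
  using seq_norm_tendsto[of X] LIMSEQ_unique unfolding null_seq_def padic_null_def by metis

lemma seq_norm_minus: "seq_norm (- X) = seq_norm X"
  by (simp add: seq_norm.rep_eq uminus_padic_seq.rep_eq)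

lemma seq_norm_add: "seq_norm (X + Y) \<le> seq_norm X + seq_norm Y"
  for X Y :: "'p::prime_card padic_seq"
  by (rule LIMSEQ_le[OF seq_norm_tendsto tendsto_add[OF seq_norm_tendsto seq_norm_tendsto]])
    (simp add: plus_padic_seq.rep_eq padic_abs_triangle prime_card)

lift_definition padic_norm :: "'p::prime_card padic \<Rightarrow> real" is seq_norm
proof -
  fix X Y :: "'p padic_seq" assume XY: "padic_equiv X Y"
  then have "seq_norm (X - Y) = 0" "seq_norm (- (X - Y)) = 0"
    by (simp_all only: padic_equiv_def seq_norm_eq_0 null_seq_minus)
  then show "seq_norm X = seq_norm Y"
    using seq_norm_add[of "X - Y" Y] seq_norm_add[of "- (X - Y)" X] by simp
qed

instantiation padic :: (prime_card) metric_space
begin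

definition dist_padic :: "'a padic \<Rightarrow> 'a padic \<Rightarrow> real" where
  "dist_padic x y = padic_norm (x - y)"

definition uniformity_padic :: "('a padic \<times> 'a padic) filter" where
  "uniformity_padic = (INF e\<in>{0 <..}. principal {(x, y). dist x y < e})"

definition open_padic :: "'a padic set \<Rightarrow> bool" where
  "open_padic U \<longleftrightarrow> (\<forall>x\<in>U. eventually (\<lambda>(x', y). x' = x \<longrightarrow> y \<in> U) uniformity)"

instance
proof
  fix x y z :: "'a padic"
  show "dist x y = 0 \<longleftrightarrow> x = y"
    unfolding dist_padic_def by transfer (simp add: seq_norm_eq_0 padic_equiv_def)
  have minus: "padic_norm (- w) = padic_norm w" for w :: "'a padic" by transfer (rule seq_norm_minus)
  have add: "padic_norm (v + w) \<le> padic_norm v + padic_norm w" for v w :: "'a padic"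
    by transfer (rule seq_norm_add)
  show "dist x y \<le> dist x z + dist y z"
    using add[of "x - z" "- (y - z)"] minus[of "y - z"] by (simp add: dist_padic_def)
qed (rule uniformity_padic_def open_padic_def)+

end

definition padic_ball :: "int \<Rightarrow> 'p::prime_card padic \<Rightarrow> 'p padic set" where
  "padic_ball \<gamma> c = {x. padic_norm (x - c) \<le> real CARD('p) powi \<gamma>}"

definition padic_scale :: "int \<Rightarrow> 'p::prime_card padic set \<Rightarrow> 'p padic set" where
  "padic_scale j A = (\<lambda>a. of_nat CARD('p) powi j * a) ` A"

definition digit_expansion :: "'p::prime_card padic \<Rightarrow> (int \<Rightarrow> nat) \<Rightarrow> bool" where
  "digit_expansion x d \<longleftrightarrow>
     (\<forall>j. d j < CARD('p)) \<and> (\<exists>\<gamma>. \<forall>j<\<gamma>. d j = 0) \<and>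
     (\<lambda>n. \<Sum>j = - int n..int n. of_nat (d j) * of_nat CARD('p) powi j) \<longlonglongrightarrow> x"

definition padic_digits :: "'p::prime_card padic \<Rightarrow> int \<Rightarrow> nat" where
  "padic_digits x = (THE d. digit_expansion x d)"

definition frac_part :: "'p::prime_card padic \<Rightarrow> rat" where
  "frac_part x =
     (\<Sum>j\<in>{j. j < 0 \<and> padic_digits x j \<noteq> 0}. of_nat (padic_digits x j) * of_nat CARD('p) powi j)"

definition padic_I :: "'p::prime_card padic set" where
  "padic_I = {x. of_rat (frac_part x) = x}"

definition padic_char :: "'p::prime_card padic \<Rightarrow> complex" where
  "padic_char x = exp (2 * of_real pi * \<i> * of_rat (frac_part x))"

text \<open>As with \<^const>\<open>lebesgue\<close>, the measurable sets are those of the completion of the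
  Borel Haar measure.\<close>

definition padic_haar :: "'p::prime_card padic measure \<Rightarrow> bool" where
  "padic_haar \<mu> \<longleftrightarrow> (\<exists>\<nu>. sets \<nu> = sets borel \<and> (\<forall>a. distr \<nu> borel ((+) a) = \<nu>) \<and>
     emeasure \<nu> (padic_ball 0 0) = 1 \<and> \<mu> = completion \<nu>)"

definition L2 :: "'a measure \<Rightarrow> ('a \<Rightarrow> complex) set" where
  "L2 \<mu> = {f \<in> borel_measurable \<mu>. integrable \<mu> (\<lambda>x. (norm (f x))\<^sup>2)}"

definition L2_norm :: "'a measure \<Rightarrow> ('a \<Rightarrow> complex) \<Rightarrow> real" where
  "L2_norm \<mu> f = sqrt (\<integral>x. (norm (f x))\<^sup>2 \<partial>\<mu>)"

definition L2_inner :: "'a measure \<Rightarrow> ('a \<Rightarrow> complex) \<Rightarrow> ('a \<Rightarrow> complex) \<Rightarrow> complex" where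
  "L2_inner \<mu> f g = (\<integral>x. f x * cnj (g x) \<partial>\<mu>)"

text \<open>Elements of \<^const>\<open>L2\<close> are functions, not classes. Closedness under
  norm limits makes a closed subspace invariant under changes on null sets.\<close>

definition closed_L2_subspace :: "'a measure \<Rightarrow> ('a \<Rightarrow> complex) set \<Rightarrow> bool" where
  "closed_L2_subspace \<mu> V \<longleftrightarrow>
     V \<subseteq> L2 \<mu> \<and> (\<lambda>_. 0) \<in> V \<and>
     (\<forall>f\<in>V. \<forall>g\<in>V. (\<lambda>x. f x + g x) \<in> V) \<and>
     (\<forall>c. \<forall>f\<in>V. (\<lambda>x. c * f x) \<in> V) \<and>
     (\<forall>F f. (\<forall>n. F n \<in> V) \<and> f \<in> L2 \<mu> \<and>
        (\<lambda>n. L2_norm \<mu> (\<lambda>x. F n x - f x)) \<longlonglongrightarrow> 0 \<longrightarrow> f \<in> V)"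

definition L2_orthonormal_basis ::
    "'a measure \<Rightarrow> 'i set \<Rightarrow> ('i \<Rightarrow> 'a \<Rightarrow> complex) \<Rightarrow> ('a \<Rightarrow> complex) set \<Rightarrow> bool" where
  "L2_orthonormal_basis \<mu> I e V \<longleftrightarrow>
     (\<forall>i\<in>I. e i \<in> V) \<and>
     (\<forall>i\<in>I. \<forall>j\<in>I. L2_inner \<mu> (e i) (e j) = (if i = j then 1 else 0)) \<and>
     (\<forall>f\<in>V. \<forall>\<epsilon>>0. \<exists>J c. finite J \<and> J \<subseteq> I \<and>
        L2_norm \<mu> (\<lambda>x. f x - (\<Sum>i\<in>J. c i * e i x)) < \<epsilon>)"

text \<open>The integral formula is the \<open>L\<^sup>2\<close> transform only on integrable functions in \<open>L\<^sup>2\<close>.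
  It is applied to indicator functions, for which being in \<open>L\<^sup>2\<close> and being integrable are
  the same; \<open>scaling_set\<close> below requires it explicitly.\<close>

definition inv_fourier ::
    "'p::prime_card padic measure \<Rightarrow> ('p padic \<Rightarrow> complex) \<Rightarrow> 'p padic \<Rightarrow> complex" where
  "inv_fourier \<mu> f \<xi> = (\<integral>x. padic_char (- (\<xi> * x)) * f x \<partial>\<mu>)"

definition locally_constant :: "('p::prime_card padic \<Rightarrow> 'b) \<Rightarrow> bool" where
  "locally_constant f \<longleftrightarrow> (\<forall>x. \<exists>\<gamma>. \<forall>y\<in>padic_ball \<gamma> x. f y = f x)"

text \<open>\<open>test_space N M\<close> is \<open>\<D>\<^sub>N\<^sup>M\<close>.\<close>

definition test_space :: "int \<Rightarrow> int \<Rightarrow> ('p::prime_card padic \<Rightarrow> complex) set" where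
  "test_space N M = {f. locally_constant f \<and>
     (\<forall>x. f (x + of_nat CARD('p) powi M) = f x) \<and> (\<forall>x. x \<notin> padic_ball N 0 \<longrightarrow> f x = 0)}"

definition scaling_function ::
    "'p::prime_card padic measure \<Rightarrow> (int \<Rightarrow> ('p padic \<Rightarrow> complex) set)
       \<Rightarrow> ('p padic \<Rightarrow> complex) \<Rightarrow> bool" where
  "scaling_function \<mu> V \<phi> \<longleftrightarrow>
     \<phi> \<in> V 0 \<and> L2_orthonormal_basis \<mu> padic_I (\<lambda>a x. \<phi> (x - a)) (V 0)"

definition MRA ::
    "'p::prime_card padic measure \<Rightarrow> (int \<Rightarrow> ('p padic \<Rightarrow> complex) set) \<Rightarrow> bool" where
  "MRA \<mu> V \<longleftrightarrow>
     (\<forall>j. closed_L2_subspace \<mu> (V j)) \<and>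
     (\<forall>j. V j \<subseteq> V (j + 1)) \<and>
     (\<forall>f\<in>L2 \<mu>. \<forall>\<epsilon>>0. \<exists>j. \<exists>g\<in>V j. L2_norm \<mu> (\<lambda>x. f x - g x) < \<epsilon>) \<and>
     (\<forall>f\<in>(\<Inter>j. V j). AE x in \<mu>. f x = 0) \<and>
     (\<forall>j f. f \<in> V j \<longleftrightarrow> (\<lambda>x. f (inverse (of_nat CARD('p)) * x)) \<in> V (j + 1)) \<and>
     (\<exists>\<phi>. scaling_function \<mu> V \<phi>)"

definition scaling_set :: "'p::prime_card padic measure \<Rightarrow> 'p padic set \<Rightarrow> bool" where
  "scaling_set \<mu> S \<longleftrightarrow> S \<in> sets \<mu> \<and> indicator S \<in> L2 \<mu> \<and>
     (\<exists>V. MRA \<mu> V \<and> scaling_function \<mu> V (inv_fourier \<mu> (indicator S)))"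

text \<open>The inverse transform of \<open>\<one>\<^sub>S\<close> determines \<open>S\<close> only up to a null set, so it says nothing
  about which integers lie in a scaled copy of \<open>S\<close>: the integers are a null set. Membership of
  single points refers to the version of \<open>S\<close> whose indicator function is locally constant. When
  \<open>\<one>\<^sub>S\<close> itself is locally constant, this version is \<open>S\<close>.\<close>

definition locally_constant_version ::
    "'p::prime_card padic measure \<Rightarrow> 'p padic set \<Rightarrow> 'p padic set \<Rightarrow> bool" where
  "locally_constant_version \<mu> S T \<longleftrightarrow>
     locally_constant (indicator T :: 'p padic \<Rightarrow> complex) \<and> (AE x in \<mu>. x \<in> T \<longleftrightarrow> x \<in> S)"

end

theory Submission
  imports Defs
begin

text \<open>
  Write \<open>\<phi>\<close> for the inverse Fourier transform of \<open>\<one>\<^sub>S\<close>. The translates of \<open>\<phi>\<close> are orthonormal, so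
  \<open>\<phi>\<close> has norm \<open>1\<close> and Plancherel's theorem says that \<open>S\<close> has Haar measure \<open>1\<close>. The two conditions
  on \<open>\<phi>\<close> describe the shape of \<open>S\<close>: that \<open>\<phi>\<close> is supported in \<open>B\<^sub>N(0)\<close> makes \<open>S\<close>, up to a null set, a
  union of balls of radius \<open>p ^ (- N)\<close>; that \<open>\<phi>\<close> has period \<open>p ^ M\<close> puts these balls inside \<open>B\<^sub>M(0)\<close>.
  The ball \<open>B\<^sub>M(0)\<close> consists of \<open>p ^ (M + N)\<close> balls of radius \<open>p ^ (- N)\<close>, centred at the points
  \<open>n / p ^ M\<close> with \<open>0 \<le> n < p ^ (M + N)\<close>. Each has measure \<open>p ^ (- N)\<close>, so exactly \<open>p ^ N\<close> of them
  make up a set of measure \<open>1\<close>, and these correspond to the integers \<open>n\<close> in \<open>p ^ M S\<close>, once \<open>S\<close> is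
  replaced by that union of balls.

  The Fourier analysis rests on a single identity. By Fubini's theorem, integrating
  \<open>\<chi>(\<xi> y) \<phi>(\<xi>)\<close> over \<open>B\<^sub>k(0)\<close> gives \<open>p ^ k\<close> times the measure of \<open>S \<inter> B\<^sub>-\<^sub>k(y)\<close>, which is the mean
  density of \<open>S\<close> in a small ball around \<open>y\<close> (\<open>integral_inv_fourier_ball\<close>). If \<open>\<phi>\<close> vanishes outside
  \<open>B\<^sub>N(0)\<close>, the integral is the same for all \<open>k \<ge> N\<close>, so \<open>S\<close> has one and the same density \<open>c\<close> in all
  balls inside a ball \<open>B\<close> of radius \<open>p ^ (- N)\<close>. Balls generate the Borel sets and are stable under
  intersection, so \<open>S \<inter> B\<close> has density \<open>c\<close> in every measurable part of \<open>B\<close> (\<open>emeasure_Int_borel\<close>). Taking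
  \<open>S \<inter> B\<close> for that part gives \<open>c = c * c\<close>, so that \<open>B\<close> lies in \<open>S\<close> or is disjoint from \<open>S\<close>, up to null
  sets (\<open>local_density_0_or_1\<close>). This replaces Lebesgue's density theorem, and with it Fourier
  inversion and Plancherel's theorem for \<open>\<one>\<^sub>S\<close> (\<open>plancherel\<close>) come for free.

  What is needed of the field itself is that p-adic integers have residues modulo \<open>p ^ n\<close>, which
  splits balls and determines their measure, and that \<open>\<chi>\<close> is a character that is trivial exactly on
  the unit ball.
\<close>

section \<open>The absolute value\<close>

lemma card_prime_gt_1: "CARD('p::prime_card) > 1"
  using prime_gt_1_nat[OF prime_card[where 'a = 'p]] .

lemma card_prime_pos [simp]: "real CARD('p::prime_card) > 0" "real CARD('p) > 1"
  using card_prime_gt_1[where 'p = 'p] by auto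

lemma padic_norm_abs_padic: "padic_norm (abs_padic X) = seq_norm X"
  by (simp add: padic_norm.abs_eq)

lemma padic_norm_0 [simp]: "padic_norm 0 = 0"
  by (metis diff_self dist_padic_def dist_self)

lemma padic_norm_eq_0 [simp]: "padic_norm x = 0 \<longleftrightarrow> x = 0"
  using dist_eq_0_iff[of x 0] by (simp add: dist_padic_def)

lemma padic_norm_nonneg [simp]: "padic_norm x \<ge> 0"
  using zero_le_dist[of x 0] unfolding dist_padic_def by simp

lemma padic_norm_minus [simp]: "padic_norm (- x) = padic_norm x"
  using dist_commute[of 0 x] by (simp add: dist_padic_def)

lemma padic_norm_diff_commute: "padic_norm (x - y) = padic_norm (y - x)"
  using dist_commute[of x y] by (simp add: dist_padic_def)

lemma padic_norm_mult [simp]: "padic_norm (x * y) = padic_norm x * padic_norm y"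
proof (transfer)
  fix X Y :: "'a padic_seq"
  have "(\<lambda>n. padic_abs CARD('a) (seq_nth (X * Y) n)) \<longlonglongrightarrow> seq_norm X * seq_norm Y"
    using tendsto_mult[OF seq_norm_tendsto[of X] seq_norm_tendsto[of Y]]
    by (simp add: times_padic_seq.rep_eq padic_abs_mult prime_card)
  then show "seq_norm (X * Y) = seq_norm X * seq_norm Y"
    using seq_norm_tendsto LIMSEQ_unique by blast
qed

lemma padic_norm_add: "padic_norm (x + y) \<le> max (padic_norm x) (padic_norm y)"
proof (transfer)
  fix X Y :: "'a padic_seq"
  show "seq_norm (X + Y) \<le> max (seq_norm X) (seq_norm Y)"
    by (rule LIMSEQ_le[OF seq_norm_tendsto tendsto_max[OF seq_norm_tendsto seq_norm_tendsto]])
      (simp add: plus_padic_seq.rep_eq padic_abs_add prime_card)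
qed

lemma padic_norm_add_le: "padic_norm x \<le> r \<Longrightarrow> padic_norm y \<le> r \<Longrightarrow> padic_norm (x + y) \<le> r"
  using padic_norm_add[of x y] by linarith

lemma padic_norm_diff_le: "padic_norm x \<le> r \<Longrightarrow> padic_norm y \<le> r \<Longrightarrow> padic_norm (x - y) \<le> r"
  using padic_norm_add_le[of x r "- y"] by simp

lemma padic_norm_1 [simp]: "padic_norm 1 = 1"
  using padic_norm_mult[of 1 1] by (simp del: padic_norm_mult)

lemma padic_norm_power [simp]: "padic_norm (x ^ n) = padic_norm x ^ n"
  by (induction n) auto

lemma padic_norm_inverse [simp]: "padic_norm (inverse x) = inverse (padic_norm x)"
proof (cases "x = 0")
  case False
  then have "padic_norm x * padic_norm (inverse x) = 1"
    by (simp flip: padic_norm_mult)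
  then show ?thesis by (simp add: inverse_unique)
qed auto

lemma padic_norm_divide [simp]: "padic_norm (x / y) = padic_norm x / padic_norm y"
  by (simp add: divide_inverse)

lemma padic_norm_powi [simp]: "padic_norm (x powi n) = padic_norm x powi n"
  by (simp add: power_int_def)

lift_definition const_seq :: "rat \<Rightarrow> 'p::prime_card padic_seq" is "\<lambda>q _. q" by simp

lemma of_nat_eq_const_seq: "(of_nat n :: 'p::prime_card padic) = abs_padic (const_seq (of_nat n))"
proof -
  have "seq_nth (of_nat n :: 'p padic_seq) = seq_nth (const_seq (of_nat n))"
    by (simp add: of_nat_padic_seq const_seq.rep_eq)
  then have "(of_nat n :: 'p padic_seq) = const_seq (of_nat n)"
    by (rule iffD1[OF seq_nth_inject])
  then show ?thesis by (simp add: of_nat_padic)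
qed

lemma of_int_eq_const_seq: "(of_int n :: 'p::prime_card padic) = abs_padic (const_seq (of_int n))"
proof (cases n rule: int_cases)
  case (neg k)
  have "(- of_nat (Suc k) :: 'p padic) = abs_padic (- const_seq (of_nat (Suc k)))"
    by (simp only: of_nat_eq_const_seq uminus_padic.abs_eq)
  also have "(- const_seq (of_nat (Suc k)) :: 'p padic_seq) = const_seq (of_int (- int (Suc k)))"
    by transfer auto
  finally show ?thesis using neg by simp
qed (simp add: of_nat_eq_const_seq)

lemma of_rat_eq_const_seq: "(of_rat q :: 'p::prime_card padic) = abs_padic (const_seq q)"
proof -
  obtain a b where q: "q = of_int a / of_int b" "b \<noteq> 0" by (rule rat_as_divide)
  have "(const_seq q * const_seq (of_int b) :: 'p padic_seq) = const_seq (of_int a)"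
    using q(2) unfolding q(1) by transfer auto
  then have "abs_padic (const_seq q) * of_int b = (of_int a :: 'p padic)"
    by (metis of_int_eq_const_seq times_padic.abs_eq)
  then have "abs_padic (const_seq q) = (of_int a / of_int b :: 'p padic)"
    using q(2) by (simp add: nonzero_eq_divide_eq)
  also have "\<dots> = of_rat q" by (simp add: q of_rat_divide)
  finally show ?thesis by simp
qed

lemma padic_norm_of_rat: "padic_norm (of_rat q :: 'p::prime_card padic) = padic_abs CARD('p) q"
  by (simp add: of_rat_eq_const_seq padic_norm_abs_padic seq_norm.rep_eq const_seq.rep_eq)

lemma of_rat_dense:
  fixes x :: "'p::prime_card padic"
  assumes "e > 0"
  obtains q where "padic_norm (x - of_rat q) \<le> e"
proof -
  obtain X where x: "x = abs_padic X" by (metis Quotient3_abs_rep Quotient3_padic)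
  obtain k where k: "\<And>m n. m \<ge> k \<Longrightarrow> n \<ge> k \<Longrightarrow> padic_abs CARD('p) (seq_nth X m - seq_nth X n) < e"
    using Cauchy_seq_nth[of X] assms unfolding padic_Cauchy_def by blast
  let ?q = "seq_nth X k"
  have "x - of_rat ?q = abs_padic (X - const_seq ?q)"
    by (simp add: x of_rat_eq_const_seq minus_padic.abs_eq)
  then have "padic_norm (x - of_rat ?q) = seq_norm (X - const_seq ?q)"
    by (simp add: padic_norm_abs_padic)
  also have "\<dots> \<le> e"
    by (rule LIMSEQ_le_const2[OF seq_norm_tendsto], rule exI[of _ k])
      (auto simp: minus_padic_seq.rep_eq const_seq.rep_eq intro!: less_imp_le k)
  finally show ?thesis using that by blast
qed

lemma padic_norm_of_int:
  "a \<noteq> 0 \<Longrightarrow> padic_norm (of_int a :: 'p::prime_card padic)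
     = real CARD('p) powi (- int (multiplicity (int CARD('p)) a))"
  using padic_norm_of_rat[of "of_int a", where 'p = 'p]
    padic_abs_divide[of "CARD('p)" a 1] by (simp add: prime_card)

lemma padic_norm_of_int_le_1 [simp]: "padic_norm (of_int a :: 'p::prime_card padic) \<le> 1"
  by (cases "a = 0") (use card_prime_gt_1[where 'p = 'p] in
    \<open>auto simp: padic_norm_of_int power_int_minus inverse_le_1_iff\<close>)

lemma padic_norm_of_nat_le_1 [simp]: "padic_norm (of_nat a :: 'p::prime_card padic) \<le> 1"
  using padic_norm_of_int_le_1[of "int a"] by (simp del: padic_norm_of_int_le_1)

lemma padic_norm_card [simp]: "padic_norm (of_nat CARD('p) :: 'p::prime_card padic) = inverse (real CARD('p))"
  using padic_norm_of_int[of "int CARD('p)", where 'p = 'p] card_prime_gt_1[where 'p = 'p]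
    multiplicity_self[of "int CARD('p)"]
  by (simp add: power_int_minus)

lemma padic_norm_of_int_le_iff:
  "padic_norm (of_int a :: 'p::prime_card padic) \<le> inverse (real CARD('p) ^ n)
     \<longleftrightarrow> int CARD('p) ^ n dvd a"
proof
  assume "int CARD('p) ^ n dvd a"
  then obtain b where "a = int CARD('p) ^ n * b" by blast
  then have "padic_norm (of_int a :: 'p padic) = inverse (real CARD('p) ^ n) * padic_norm (of_int b :: 'p padic)"
    by (simp add: power_inverse)
  also have "\<dots> \<le> inverse (real CARD('p) ^ n) * 1"
    by (intro mult_left_mono) auto
  finally show "padic_norm (of_int a :: 'p padic) \<le> inverse (real CARD('p) ^ n)" by simp
next
  assume *: "padic_norm (of_int a :: 'p padic) \<le> inverse (real CARD('p) ^ n)"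
  show "int CARD('p) ^ n dvd a"
  proof (cases "a = 0")
    case False
    let ?m = "multiplicity (int CARD('p)) a"
    have "inverse (real CARD('p) ^ ?m) \<le> inverse (real CARD('p) ^ n)"
      using * False by (simp add: padic_norm_of_int power_int_minus)
    then have "real CARD('p) ^ n \<le> real CARD('p) ^ ?m"
      by simp
    then have "n \<le> ?m" by (rule power_le_imp_le_exp[rotated]) (use card_prime_gt_1[where 'p = 'p] in simp)
    then show ?thesis by (rule multiplicity_dvd')
  qed auto
qed

section \<open>Residues of p-adic integers\<close>

text \<open>An approximating rational \<open>u / v\<close> in lowest terms has absolute value at most \<open>1\<close>, so \<open>p\<close> does not
  divide \<open>v\<close>. Then \<open>v\<close> is invertible modulo \<open>p ^ n\<close>, and \<open>u\<close> times its inverse is the residue.\<close>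

lemma padic_int_residue:
  fixes x :: "'p::prime_card padic"
  assumes "padic_norm x \<le> 1"
  obtains a where "a < CARD('p) ^ n" "padic_norm (x - of_nat a) \<le> inverse (real CARD('p) ^ n)"
proof -
  let ?P = "int CARD('p)" and ?e = "inverse (real CARD('p) ^ n)"
  have e: "?e > 0" "?e \<le> 1" by (simp_all add: inverse_le_1_iff)
  obtain q where q: "padic_norm (x - of_rat q) \<le> ?e" using of_rat_dense[OF e(1)] .
  have "padic_norm (x - (x - of_rat q)) \<le> 1"
    by (rule padic_norm_diff_le) (use assms q e in auto)
  then have q1: "padic_norm (of_rat q :: 'p padic) \<le> 1" by simp
  obtain u v where uv: "quotient_of q = (u, v)" by (cases "quotient_of q")
  have v: "v > 0" "coprime u v" and quv: "q = of_int u / of_int v"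
    using uv quotient_of_denom_pos quotient_of_coprime quotient_of_div by auto
  have nd: "\<not> ?P dvd v"
  proof
    assume d: "?P dvd v"
    then have "\<not> ?P dvd u" using v card_prime_gt_1[where 'p = 'p]
      by (metis coprime_common_divisor int_one_le_iff_zero_less linorder_not_less of_nat_0_less_iff
          not_prime_unit of_nat_1 of_nat_less_iff prime_card_int zdvd1_eq)
    then have "u \<noteq> 0" and "multiplicity ?P u = 0" by (auto simp: not_dvd_imp_multiplicity_0)
    then have nu: "padic_norm (of_int u :: 'p padic) = 1" by (simp add: padic_norm_of_int)
    have "padic_norm (of_int v :: 'p padic) \<le> inverse (real CARD('p) ^ 1)"
      using d by (subst padic_norm_of_int_le_iff) auto
    also have "\<dots> < 1" using card_prime_gt_1[where 'p = 'p] by (simp add: inverse_less_1_iff)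
    finally have nv: "padic_norm (of_int v :: 'p padic) < 1" .
    have "padic_norm (of_int v :: 'p padic) > 0"
      using v by (simp add: less_le)
    with nv nu q1 show False by (simp add: quv of_rat_divide field_simps)
  qed
  then have cop: "coprime (?P ^ n) v"
    using prime_imp_coprime[OF prime_card_int[where 'a = 'p] nd] by simp
  obtain w where w: "[v * w = 1] (mod (?P ^ n))"
    using cop coprime_commute cong_solve_coprime_int by metis
  have nv: "padic_norm (of_int v :: 'p padic) = 1"
    using nd v by (simp add: padic_norm_of_int not_dvd_imp_multiplicity_0)
  define b where "b = (u * w) mod ?P ^ n"
  have b: "0 \<le> b" "b < ?P ^ n" by (simp_all add: b_def)
  have "[u - b * v = u - (u * w) * v] (mod ?P ^ n)"
    by (intro cong_diff cong_mult cong_refl) (simp add: b_def)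
  also have "u - (u * w) * v = u - u * (v * w)" by simp
  also have "[u - u * (v * w) = u - u * 1] (mod ?P ^ n)"
    by (intro cong_diff cong_mult w) auto
  finally have "?P ^ n dvd u - b * v" by (simp add: cong_0_iff)
  then have "padic_norm (of_int (u - b * v) :: 'p padic) \<le> ?e"
    by (subst padic_norm_of_int_le_iff)
  moreover have "of_rat q - of_int b = (of_int (u - b * v) / of_int v :: 'p padic)"
    using v by (simp add: quv of_rat_divide field_simps)
  ultimately have "padic_norm (of_rat q - of_int b :: 'p padic) \<le> ?e" using nv by simp
  from padic_norm_add_le[OF q this] have "padic_norm (x - of_int b) \<le> ?e" by simp
  moreover have "(of_int b :: 'p padic) = of_nat (nat b)" using b by simp
  moreover have "nat b < CARD('p) ^ n" using b by (simp add: nat_less_iff)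
  ultimately show ?thesis using that by metis
qed

lemma padic_int_residue_unique:
  fixes x :: "'p::prime_card padic"
  assumes "a < CARD('p) ^ n" "padic_norm (x - of_nat a) \<le> inverse (real CARD('p) ^ n)"
    and "b < CARD('p) ^ n" "padic_norm (x - of_nat b) \<le> inverse (real CARD('p) ^ n)"
  shows "a = b"
proof -
  have "padic_norm ((x - of_nat b) - (x - of_nat a)) \<le> inverse (real CARD('p) ^ n)"
    by (intro padic_norm_diff_le assms)
  then have "padic_norm (of_int (int a - int b) :: 'p padic) \<le> inverse (real CARD('p) ^ n)"
    by simp
  then have "int CARD('p) ^ n dvd int a - int b" by (subst (asm) padic_norm_of_int_le_iff)
  then have "int a mod int CARD('p) ^ n = int b mod int CARD('p) ^ n"
    by (simp add: mod_eq_dvd_iff)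
  then have "int a = int b"
    using assms(1,3) by (metis mod_less of_nat_mod of_nat_power)
  then show ?thesis by simp
qed

section \<open>Digits, fractional part and the additive character\<close>

abbreviation unif :: "'p::prime_card padic" where
  "unif \<equiv> of_nat CARD('p)"

lemma sum_digits_less:
  assumes "\<And>i. e i < b"
  shows "(\<Sum>i<n. e i * b ^ i) < (b :: nat) ^ n"
proof (induction n)
  case (Suc n)
  have "(\<Sum>i<Suc n. e i * b ^ i) < b ^ n + e n * b ^ n" using Suc by simp
  also have "\<dots> = Suc (e n) * b ^ n" by simp
  also have "\<dots> \<le> b * b ^ n" using assms[of n] by (intro mult_right_mono) auto
  finally show ?case by simp
qed auto

text \<open>The residues modulo \<open>p ^ n\<close> are compatible for varying \<open>n\<close> because they are unique; the digits
  are those by which consecutive residues differ.\<close>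

lemma padic_int_digits_exist:
  fixes y :: "'p::prime_card padic"
  assumes "padic_norm y \<le> 1"
  obtains e where "\<And>i. e i < CARD('p)"
    "\<And>n. padic_norm (y - of_nat (\<Sum>i<n. e i * CARD('p) ^ i)) \<le> inverse (real CARD('p) ^ n)"
proof -
  let ?P = "CARD('p)"
  have "\<exists>a<?P ^ n. padic_norm (y - of_nat a) \<le> inverse (real ?P ^ n)" for n
    using padic_int_residue[OF assms, of n] by blast
  then obtain a where a: "\<And>n. a n < ?P ^ n"
    "\<And>n. padic_norm (y - of_nat (a n)) \<le> inverse (real ?P ^ n)" by metis
  have mod: "a (Suc n) mod ?P ^ n = a n" for n
  proof (rule padic_int_residue_unique)
    show "a (Suc n) mod ?P ^ n < ?P ^ n" by simp
    have "a (Suc n) - a (Suc n) mod ?P ^ n = ?P ^ n * (a (Suc n) div ?P ^ n)"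
      by (simp add: minus_mod_eq_mult_div)
    then have "int (a (Suc n)) - int (a (Suc n) mod ?P ^ n) = int ?P ^ n * int (a (Suc n) div ?P ^ n)"
      by (metis mod_less_eq_dividend of_nat_diff of_nat_mult of_nat_power)
    then have "padic_norm (of_int (int (a (Suc n)) - int (a (Suc n) mod ?P ^ n)) :: 'p padic)
        \<le> inverse (real ?P ^ n)"
      by (subst padic_norm_of_int_le_iff) auto
    moreover have "inverse (real ?P ^ Suc n) \<le> inverse (real ?P ^ n)"
      using card_prime_gt_1[where 'p = 'p] by (intro le_imp_inverse_le power_increasing) auto
    then have "padic_norm (y - of_nat (a (Suc n))) \<le> inverse (real ?P ^ n)"
      using a(2)[of "Suc n"] by linarith
    ultimately have "padic_norm ((y - of_nat (a (Suc n)))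
        + of_int (int (a (Suc n)) - int (a (Suc n) mod ?P ^ n))) \<le> inverse (real ?P ^ n)"
      by (intro padic_norm_add_le)
    then show "padic_norm (y - of_nat (a (Suc n) mod ?P ^ n)) \<le> inverse (real ?P ^ n)" by simp
  qed (rule a)+
  define e where "e i = a (Suc i) div ?P ^ i" for i
  have "e i < ?P" for i
    using a(1)[of "Suc i"] by (simp add: e_def less_mult_imp_div_less)
  moreover have "(\<Sum>i<n. e i * ?P ^ i) = a n" for n
  proof (induction n)
    case 0
    then show ?case using a(1)[of 0] by simp
  next
    case (Suc n)
    then show ?case
      using mod[of n] div_mult_mod_eq[of "a (Suc n)" "?P ^ n"] by (simp add: e_def)
  qed
  ultimately show ?thesis using that a(2) by metis
qed

lemma padic_norm_bounded_power:
  fixes x :: "'p::prime_card padic"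
  obtains k where "padic_norm x \<le> real CARD('p) ^ k"
  using real_arch_pow[of "real CARD('p)" "padic_norm x"] card_prime_pos(2) less_imp_le by blast

text \<open>The factor \<open>p ^ (- m)\<close> reduces an expansion that starts at \<open>- m\<close> to one of a p-adic integer, with
  partial sums that are natural numbers.\<close>

lemma sum_digits_shift:
  fixes d :: "int \<Rightarrow> nat"
  assumes "\<And>j. j < - int m \<Longrightarrow> d j = 0" and "m \<le> K"
  shows "(\<Sum>j = - int K..int K. of_nat (d j) * unif powi j)
    = unif powi (- int m) * (of_nat (\<Sum>i<K + m + 1. d (int i - int m) * CARD('p) ^ i) :: 'p::prime_card padic)"
proof -
  have "(\<Sum>j = - int K..int K. of_nat (d j) * (unif :: 'p padic) powi j)
      = (\<Sum>j = - int m..int K. of_nat (d j) * unif powi j)"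
    using assms by (intro sum.mono_neutral_right) auto
  also have "\<dots> = (\<Sum>i<K + m + 1. of_nat (d (int i - int m)) * unif powi (int i - int m))"
    by (rule sum.reindex_bij_witness[of _ "\<lambda>i. int i - int m" "\<lambda>j. nat (j + int m)"]) auto
  also have "\<dots> = (\<Sum>i<K + m + 1. unif powi (- int m) * (of_nat (d (int i - int m)) * unif ^ i))"
    by (intro sum.cong refl) (simp add: power_int_diff power_int_minus field_simps)
  also have "\<dots> = unif powi (- int m) * (\<Sum>i<K + m + 1. of_nat (d (int i - int m)) * unif ^ i)"
    by (rule sum_distrib_left[symmetric])
  finally show ?thesis by (simp only: of_nat_sum of_nat_mult of_nat_power)
qed

lemma padic_limit_le:
  assumes "X \<longlonglongrightarrow> x" "\<And>n. n \<ge> k \<Longrightarrow> padic_norm (X n - c) \<le> r"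
  shows "padic_norm (x - c) \<le> r"
proof -
  have "x \<in> cball c r"
    by (rule Lim_in_closed_set[OF closed_cball _ _ assms(1)])
      (auto simp: eventually_sequentially dist_padic_def padic_norm_diff_commute[of c]
        intro!: exI[of _ k] assms(2))
  then show ?thesis by (simp add: dist_padic_def padic_norm_diff_commute[of c])
qed

text \<open>The terms that follow the first \<open>n\<close> ones are small, and by the ultrametric inequality so is their
  sum, however many there are.\<close>

lemma digit_expansion_partial_sum:
  fixes x :: "'p::prime_card padic"
  assumes "digit_expansion x d" and d0: "\<And>j. j < - int m \<Longrightarrow> d j = 0"
  shows "padic_norm (x - unif powi (- int m) * of_nat (\<Sum>i<n. d (int i - int m) * CARD('p) ^ i))
    \<le> real CARD('p) powi (int m - int n)"
proof (rule padic_limit_le)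
  let ?s = "\<lambda>n. \<Sum>i<n. d (int i - int m) * CARD('p) ^ i"
  show "(\<lambda>n. \<Sum>j = - int n..int n. of_nat (d j) * unif powi j) \<longlonglongrightarrow> x"
    using assms(1) by (simp add: digit_expansion_def)
  fix K assume K: "K \<ge> max m n"
  have "?s (K + m + 1) = ?s n + (\<Sum>i=n..<K + m + 1. d (int i - int m) * CARD('p) ^ i)"
    unfolding lessThan_atLeast0 by (rule sum.atLeastLessThan_concat[symmetric]) (use K in auto)
  moreover have "CARD('p) ^ n dvd (\<Sum>i=n..<K + m + 1. d (int i - int m) * CARD('p) ^ i)"
    by (intro dvd_sum dvd_mult) (auto intro: le_imp_power_dvd)
  then obtain t where "(\<Sum>i=n..<K + m + 1. d (int i - int m) * CARD('p) ^ i) = CARD('p) ^ n * t"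
    by (rule dvdE)
  ultimately have t: "?s (K + m + 1) = ?s n + CARD('p) ^ n * t" by (simp only:)
  have "padic_norm (unif powi (- int m) * of_nat (?s (K + m + 1))
        - unif powi (- int m) * of_nat (?s n) :: 'p padic)
      = padic_norm (unif powi (- int m) * unif ^ n * of_nat t :: 'p padic)"
    unfolding t
    by (simp only: of_nat_add of_nat_mult of_nat_power ring_distribs mult.assoc add_diff_cancel_left')
  also have "\<dots> = real CARD('p) powi (int m - int n) * padic_norm (of_nat t :: 'p padic)"
    by (simp add: power_int_diff power_int_minus power_int_inverse field_simps)
  also have "\<dots> \<le> real CARD('p) powi (int m - int n) * 1"
    by (intro mult_left_mono) auto
  finally show "padic_norm ((\<Sum>j = - int K..int K. of_nat (d j) * unif powi j)
        - unif powi (- int m) * of_nat (?s n) :: 'p padic) \<le> real CARD('p) powi (int m - int n)"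
    by (subst sum_digits_shift[of m d K, OF d0]) (use K in simp_all)
qed

lemma digit_expansion_exists: "\<exists>d. digit_expansion (x :: 'p::prime_card padic) d"
proof -
  let ?P = "CARD('p)"
  obtain m where m: "padic_norm x \<le> real ?P ^ m" by (rule padic_norm_bounded_power)
  define y where "y = unif ^ m * x"
  have "padic_norm y \<le> 1"
    using mult_left_mono[OF m, of "inverse (real ?P ^ m)"] by (simp add: y_def power_inverse)
  then obtain e where e: "\<And>i. e i < ?P"
    "\<And>n. padic_norm (y - of_nat (\<Sum>i<n. e i * ?P ^ i)) \<le> inverse (real ?P ^ n)"
    using padic_int_digits_exist[of y] by blast
  define d where "d j = (if j < - int m then 0 else e (nat (j + int m)))" for j
  have de: "d (int i - int m) = e i" for i by (simp add: d_def)
  have x: "x = unif powi (- int m) * y" by (simp add: y_def power_int_minus)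
  let ?X = "\<lambda>n. \<Sum>j = - int n..int n. of_nat (d j) * (unif :: 'p padic) powi j"
  have "dist (?X n) x \<le> real ?P ^ m * inverse (real ?P) ^ n" if "n \<ge> m" for n
  proof -
    have "dist (?X n) x = padic_norm (x - ?X n)" by (simp add: dist_padic_def padic_norm_diff_commute)
    also have "x - ?X n = unif powi (- int m) * (y - of_nat (\<Sum>i<n + m + 1. e i * ?P ^ i))"
      unfolding x using that by (subst sum_digits_shift[of m]) (auto simp: d_def ring_distribs)
    also have "padic_norm \<dots> = real ?P ^ m * padic_norm (y - of_nat (\<Sum>i<n + m + 1. e i * ?P ^ i))"
      by (simp only: padic_norm_mult padic_norm_powi padic_norm_card)
        (simp add: power_int_minus power_inverse)
    also have "\<dots> \<le> real ?P ^ m * inverse (real ?P ^ (n + m + 1))"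
      by (intro mult_left_mono e) auto
    also have "\<dots> \<le> real ?P ^ m * inverse (real ?P ^ n)"
      using card_prime_gt_1[where 'p = 'p]
      by (intro mult_left_mono le_imp_inverse_le power_increasing) auto
    finally show ?thesis by (simp add: power_inverse)
  qed
  then have ev: "\<forall>\<^sub>F n in sequentially. dist (?X n) x \<le> real ?P ^ m * inverse (real ?P) ^ n"
    by (auto simp: eventually_sequentially)
  have "(\<lambda>n. inverse (real ?P) ^ n) \<longlonglongrightarrow> 0"
    by (rule LIMSEQ_realpow_zero) (use card_prime_gt_1[where 'p = 'p] in \<open>auto simp: inverse_less_1_iff\<close>)
  from tendsto_mult_right_zero[OF this, of "real ?P ^ m"]
  have "(\<lambda>n. dist (?X n) x) \<longlonglongrightarrow> 0"
    by (intro tendsto_sandwich[OF _ ev tendsto_const]) auto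
  then have "?X \<longlonglongrightarrow> x" by (rule iffD2[OF tendsto_dist_iff])
  moreover have "\<forall>j. d j < ?P" using e(1) by (simp add: d_def)
  moreover have "\<exists>\<gamma>. \<forall>j<\<gamma>. d j = 0" by (rule exI[of _ "- int m"]) (simp add: d_def)
  ultimately show ?thesis unfolding digit_expansion_def by blast
qed

text \<open>The partial sums are residues of one and the same p-adic integer \<open>p ^ m * x\<close>, hence determined by
  \<open>x\<close>.\<close>

lemma digit_expansion_unique:
  fixes x :: "'p::prime_card padic"
  assumes d: "digit_expansion x d" and d': "digit_expansion x d'"
  shows "d = d'"
proof
  fix j :: int
  let ?P = "CARD('p)"
  obtain g g' where g: "\<And>j. j < g \<Longrightarrow> d j = 0" "\<And>j. j < g' \<Longrightarrow> d' j = 0"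
    using d d' unfolding digit_expansion_def by blast
  \<comment> \<open>Both expansions start at or above \<open>- m\<close>, and the position \<open>j\<close> is covered.\<close>
  define m where "m = nat (max (- g) (max (- g') (- j)))"
  have m: "int m \<ge> - g" "int m \<ge> - g'" "int m \<ge> - j" by (auto simp: m_def)
  have d0: "\<And>j. j < - int m \<Longrightarrow> d j = 0" "\<And>j. j < - int m \<Longrightarrow> d' j = 0"
    by (rule g; use m in linarith)+
  have lt: "\<And>j. d j < ?P" "\<And>j. d' j < ?P" using d d' by (auto simp: digit_expansion_def)
  have scale: "padic_norm (unif ^ m * x - of_nat s) \<le> inverse (real ?P ^ n)"
    if "padic_norm (x - unif powi (- int m) * of_nat s) \<le> real ?P powi (int m - int n)" for s n
  proof -
    have "unif ^ m * x - of_nat s = unif ^ m * (x - unif powi (- int m) * of_nat s)"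
      by (simp add: ring_distribs power_int_minus)
    then have "padic_norm (unif ^ m * x - of_nat s)
        = inverse (real ?P ^ m) * padic_norm (x - unif powi (- int m) * of_nat s)"
      by (simp only: padic_norm_mult padic_norm_power padic_norm_card power_inverse)
    also have "\<dots> \<le> inverse (real ?P ^ m) * real ?P powi (int m - int n)"
      using that by (intro mult_left_mono) auto
    also have "\<dots> = inverse (real ?P ^ n)" by (simp add: power_int_diff field_simps)
    finally show ?thesis .
  qed
  have eq: "(\<Sum>i<n. d (int i - int m) * ?P ^ i) = (\<Sum>i<n. d' (int i - int m) * ?P ^ i)" for n
  proof (rule padic_int_residue_unique)
    show "padic_norm (unif ^ m * x - of_nat (\<Sum>i<n. d (int i - int m) * ?P ^ i)) \<le> inverse (real ?P ^ n)"
      by (rule scale, rule digit_expansion_partial_sum[OF d d0(1)])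
    show "padic_norm (unif ^ m * x - of_nat (\<Sum>i<n. d' (int i - int m) * ?P ^ i)) \<le> inverse (real ?P ^ n)"
      by (rule scale, rule digit_expansion_partial_sum[OF d' d0(2)])
  qed (intro sum_digits_less lt)+
  have "d (int i - int m) = d' (int i - int m)" for i
    using eq[of i] eq[of "Suc i"] by simp
  from this[of "nat (j + int m)"] show "d j = d' j" using m by simp
qed

lemma digit_expansion_padic_digits: "digit_expansion x (padic_digits x)"
  unfolding padic_digits_def
  using digit_expansion_exists digit_expansion_unique by (metis theI)

text \<open>The fractional part is an approximation of \<open>x\<close> up to a p-adic integer by a fraction with a power of
  \<open>p\<close> as denominator. The additive character depends on the digits only through this.\<close>

lemma frac_part_eq:
  fixes x :: "'p::prime_card padic"
  obtains a m where "a < CARD('p) ^ m" "frac_part x = of_nat a / of_nat CARD('p) ^ m"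
    "padic_norm (x - of_nat a / unif ^ m) \<le> 1"
proof -
  let ?d = "padic_digits x" and ?P = "CARD('p)"
  have d: "digit_expansion x ?d" by (rule digit_expansion_padic_digits)
  then obtain g where g: "\<And>j. j < g \<Longrightarrow> ?d j = 0" unfolding digit_expansion_def by blast
  define m where "m = nat (- g)"
  have m: "int m \<ge> - g" by (simp add: m_def)
  have d0: "\<And>j. j < - int m \<Longrightarrow> ?d j = 0" by (rule g) (use m in linarith)
  define a where "a = (\<Sum>i<m. ?d (int i - int m) * ?P ^ i)"
  have "a < ?P ^ m" unfolding a_def
    by (rule sum_digits_less) (use d in \<open>auto simp: digit_expansion_def\<close>)
  moreover have "padic_norm (x - unif powi (- int m) * of_nat a) \<le> real ?P powi (int m - int m)"
    unfolding a_def by (rule digit_expansion_partial_sum[OF d d0])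
  then have "padic_norm (x - of_nat a / unif ^ m) \<le> 1"
    by (simp add: power_int_minus field_simps)
  moreover have "frac_part x = of_nat a / of_nat ?P ^ m"
  proof -
    have "frac_part x = (\<Sum>j = - int m..<0. of_nat (?d j) * of_nat ?P powi j)"
      unfolding frac_part_def using d0
      by (intro sum.mono_neutral_left) (auto simp: not_less[symmetric])
    also have "\<dots> = (\<Sum>i<m. of_nat (?d (int i - int m)) * of_nat ?P powi (int i - int m))"
      by (rule sum.reindex_bij_witness[of _ "\<lambda>i. int i - int m" "\<lambda>j. nat (j + int m)"]) auto
    also have "\<dots> = (\<Sum>i<m. of_nat (?d (int i - int m)) * of_nat ?P ^ i / of_nat ?P ^ m)"
      by (intro sum.cong refl) (simp add: power_int_diff)
    finally show ?thesis by (simp add: a_def sum_divide_distrib)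
  qed
  ultimately show ?thesis using that by blast
qed

lemma padic_norm_frac_le_1_iff:
  "padic_norm (of_int a / unif ^ m :: 'p::prime_card padic) \<le> 1 \<longleftrightarrow> int CARD('p) ^ m dvd a"
proof -
  have "padic_norm (of_int a / unif ^ m :: 'p padic) \<le> 1
      \<longleftrightarrow> padic_norm (of_int a :: 'p padic) \<le> inverse (real CARD('p) ^ m)"
    by (simp add: power_inverse field_simps)
  then show ?thesis by (simp only: padic_norm_of_int_le_iff)
qed

lemma cis_eq_1_iff_Ints: "cis (2 * pi * x) = 1 \<longleftrightarrow> x \<in> \<int>"
proof -
  have "cis (2 * pi * x) = 1 \<longleftrightarrow> (\<exists>n::int. 2 * pi * x = of_int (2 * n) * pi)"
    by (simp add: cis_conv_exp exp_eq_1)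
  also have "\<dots> \<longleftrightarrow> (\<exists>n::int. x = of_int n)" by simp
  finally show ?thesis by (auto elim: Ints_cases)
qed

text \<open>Any approximation of \<open>x\<close> with a power of \<open>p\<close> as denominator may replace the fractional part: two
  of them differ by a rational that is a p-adic integer and has such a denominator, so by an integer.\<close>

lemma padic_char_eq:
  fixes x :: "'p::prime_card padic"
  assumes "padic_norm (x - of_int a / unif ^ m) \<le> 1"
  shows "padic_char x = cis (2 * pi * (real_of_int a / real CARD('p) ^ m))"
proof -
  let ?P = "CARD('p)"
  obtain b k where b: "frac_part x = of_nat b / of_nat ?P ^ k"
    "padic_norm (x - of_nat b / unif ^ k) \<le> 1" by (rule frac_part_eq)
  have "padic_char x = cis (2 * pi * (real b / real ?P ^ k))"
    unfolding padic_char_def b(1) by (simp add: cis_conv_exp of_rat_divide of_rat_power mult_ac)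
  moreover have "padic_norm ((x - of_nat b / unif ^ k) - (x - of_int a / unif ^ m)) \<le> 1"
    by (intro padic_norm_diff_le b assms)
  then have "padic_norm (of_int (a * int ?P ^ k - int b * int ?P ^ m) / unif ^ (m + k) :: 'p padic) \<le> 1"
    by (simp add: field_simps power_add)
  then have "int ?P ^ (m + k) dvd a * int ?P ^ k - int b * int ?P ^ m"
    by (subst (asm) padic_norm_frac_le_1_iff)
  then obtain t where "a * int ?P ^ k - int b * int ?P ^ m = int ?P ^ (m + k) * t" by blast
  then have "real_of_int (a * int ?P ^ k - int b * int ?P ^ m) = real_of_int (int ?P ^ (m + k) * t)" by simp
  then have "real_of_int a / real ?P ^ m = real b / real ?P ^ k + real_of_int t"
    by (simp add: field_simps power_add)
  moreover have "cis (2 * pi * real_of_int t) = 1" by (simp add: cis_eq_1_iff_Ints)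
  ultimately show ?thesis by (simp add: ring_distribs cis_mult[symmetric])
qed

lemma padic_approx:
  fixes x :: "'p::prime_card padic"
  obtains a m where "padic_norm (x - of_int a / unif ^ m) \<le> 1"
proof -
  obtain b m where "padic_norm (x - of_nat b / unif ^ m) \<le> 1" by (rule frac_part_eq)
  then show ?thesis by (intro that[of "int b" m]) simp
qed

lemma padic_char_add: "padic_char (x + y) = padic_char x * padic_char y" for x :: "'p::prime_card padic"
proof -
  obtain a m where a: "padic_norm (x - of_int a / unif ^ m) \<le> 1" by (rule padic_approx)
  obtain b k where b: "padic_norm (y - of_int b / unif ^ k) \<le> 1" by (rule padic_approx)
  let ?c = "a * int CARD('p) ^ k + b * int CARD('p) ^ m"
  have eq: "x + y - of_int ?c / unif ^ (m + k) = (x - of_int a / unif ^ m) + (y - of_int b / unif ^ k)"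
    by (simp add: field_simps power_add)
  have "padic_norm (x + y - of_int ?c / unif ^ (m + k)) \<le> 1"
    unfolding eq by (rule padic_norm_add_le[OF a b])
  from padic_char_eq[OF this]
  have "padic_char (x + y) = cis (2 * pi * (real_of_int a / real CARD('p) ^ m)
      + 2 * pi * (real_of_int b / real CARD('p) ^ k))"
    by (simp add: field_simps power_add)
  then show ?thesis
    by (simp only: padic_char_eq[OF a] padic_char_eq[OF b] cis_mult)
qed

lemma padic_char_eq_1_iff: "padic_char x = 1 \<longleftrightarrow> padic_norm x \<le> 1" for x :: "'p::prime_card padic"
proof -
  obtain a m where a: "padic_norm (x - of_int a / unif ^ m) \<le> 1" by (rule padic_approx)
  have "padic_norm x \<le> 1 \<longleftrightarrow> padic_norm (of_int a / unif ^ m :: 'p padic) \<le> 1"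
    using padic_norm_add_le[OF a, of "of_int a / unif ^ m"] padic_norm_diff_le[OF _ a, of x] by auto
  also have "\<dots> \<longleftrightarrow> int CARD('p) ^ m dvd a" by (rule padic_norm_frac_le_1_iff)
  also have "\<dots> \<longleftrightarrow> real_of_int a / real_of_int (int CARD('p) ^ m) \<in> \<int>"
    by (simp add: of_int_div_of_int_in_Ints_iff del: of_int_power of_int_of_nat_eq)
  also have "\<dots> \<longleftrightarrow> padic_char x = 1"
    using cis_eq_1_iff_Ints[of "real_of_int a / real CARD('p) ^ m"]
    by (simp add: padic_char_eq[OF a])
  finally show ?thesis by simp
qed

lemma norm_padic_char [simp]: "norm (padic_char x) = 1"
proof -
  obtain a m where "padic_norm (x - of_int a / unif ^ m) \<le> 1" by (rule padic_approx)
  then show ?thesis by (simp add: padic_char_eq)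
qed

lemma padic_char_0 [simp]: "padic_char 0 = 1"
  by (simp add: padic_char_eq_1_iff)

lemma padic_char_minus: "padic_char (- x) = cnj (padic_char x)"
proof -
  have "padic_char x * padic_char (- x) = padic_char x * cnj (padic_char x)"
    using padic_char_add[of x "- x"] complex_norm_square[of "padic_char x"] by simp
  moreover have "padic_char x \<noteq> 0" using norm_padic_char[of x] by force
  ultimately show ?thesis by simp
qed

lemma frac_part_0: "frac_part (0 :: 'p::prime_card padic) = 0"
proof -
  obtain a m where a: "a < CARD('p) ^ m" "frac_part (0 :: 'p padic) = of_nat a / of_nat CARD('p) ^ m"
    "padic_norm ((0 :: 'p padic) - of_nat a / unif ^ m) \<le> 1"
    by (rule frac_part_eq)
  then have "padic_norm (of_int (int a) / unif ^ m :: 'p padic) \<le> 1" by simp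
  then have "int CARD('p) ^ m dvd int a" by (simp only: padic_norm_frac_le_1_iff)
  then have "CARD('p) ^ m dvd a" unfolding of_nat_power[symmetric] of_nat_dvd_iff .
  then have "a = 0" using a(1) by (meson dvd_imp_le leD neq0_conv)
  then show ?thesis using a by simp
qed

lemma zero_in_padic_I: "0 \<in> padic_I"
  by (simp add: padic_I_def frac_part_0)

section \<open>Topology and balls\<close>

lemma tendsto_padic_norm_iff: "(f \<longlongrightarrow> l) F \<longleftrightarrow> ((\<lambda>z. padic_norm (f z - l)) \<longlongrightarrow> 0) F"
  unfolding tendsto_dist_iff[of f l F] dist_padic_def ..

instance padic :: (prime_card) topological_group_add
proof
  fix a b :: "'a padic"
  show "LIM z (nhds a \<times>\<^sub>F nhds b). fst z + snd z :> nhds (a + b)"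
  proof -
    have lim: "((\<lambda>z. padic_norm (fst z - a) + padic_norm (snd z - b)) \<longlongrightarrow> 0 + 0) (nhds a \<times>\<^sub>F nhds b)"
      by (intro tendsto_add tendsto_padic_norm_iff[THEN iffD1] filterlim_fst filterlim_snd)
    have bound: "padic_norm (x + y - (a + b)) \<le> padic_norm (x - a) + padic_norm (y - b)" for x y
      using padic_norm_add[of "x - a" "y - b"] padic_norm_nonneg[of "x - a"] padic_norm_nonneg[of "y - b"]
      unfolding add_diff_add by linarith
    show ?thesis
      unfolding tendsto_padic_norm_iff
      by (rule Lim_null_comparison[OF always_eventually lim[simplified]]) (simp add: bound)
  qed
  show "(uminus \<longlongrightarrow> - a) (nhds a)"
    using filterlim_ident[of "nhds a"] unfolding tendsto_padic_norm_iff
    by (simp add: padic_norm_diff_commute)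
qed

instance padic :: (prime_card) topological_semigroup_mult
proof
  fix a b :: "'a padic"
  show "LIM z (nhds a \<times>\<^sub>F nhds b). fst z * snd z :> nhds (a * b)"
  proof -
    let ?g = "\<lambda>z. padic_norm (fst z - a) * padic_norm (snd z - b)
      + padic_norm (fst z - a) * padic_norm b + padic_norm a * padic_norm (snd z - b)"
    have lim: "(?g \<longlongrightarrow> 0 * 0 + 0 * padic_norm b + padic_norm a * 0) (nhds a \<times>\<^sub>F nhds b)"
      by (intro tendsto_add tendsto_mult tendsto_const tendsto_padic_norm_iff[THEN iffD1]
          filterlim_fst filterlim_snd)
    have bound: "padic_norm (x * y - a * b) \<le> ?g (x, y)" for x y
    proof -
      have "x * y - a * b = ((x - a) * (y - b) + (x - a) * b) + a * (y - b)"
        by (simp add: algebra_simps)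
      also have "padic_norm \<dots> \<le> ?g (x, y)"
        using padic_norm_add[of "(x - a) * (y - b) + (x - a) * b" "a * (y - b)"]
          padic_norm_add[of "(x - a) * (y - b)" "(x - a) * b"]
          padic_norm_nonneg[of "(x - a) * (y - b)"] padic_norm_nonneg[of "(x - a) * b"]
          padic_norm_nonneg[of "a * (y - b)"]
        by (simp only: padic_norm_mult fst_conv snd_conv)
      finally show ?thesis .
    qed
    show ?thesis
      unfolding tendsto_padic_norm_iff
      by (rule Lim_null_comparison[OF always_eventually lim[simplified]]) (use bound in simp)
  qed
qed

text \<open>In a second countable space the Borel sets of the square are the product measurable sets, which
  makes continuous kernels accessible to Fubini's theorem.\<close>

instance padic :: (prime_card) second_countable_topology
proof
  define B where "B =
    (\<lambda>(q, n). ball (of_rat q :: 'a padic) (inverse (of_nat (Suc n)))) ` (UNIV :: (rat \<times> nat) set)"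
  have "topological_basis B"
  proof (rule topological_basisI)
    show "open U" if "U \<in> B" for U using that by (auto simp: B_def)
    fix U :: "'a padic set" and x assume U: "open U" "x \<in> U"
    then obtain e where e: "e > 0" "ball x e \<subseteq> U" by (meson openE)
    obtain n where n: "inverse (of_nat (Suc n)) < e / 2"
      using reals_Archimedean[of "e / 2"] e by auto
    have "inverse (of_nat (Suc n)) / 2 > (0 :: real)" by simp
    then obtain q where q: "padic_norm (x - of_rat q) \<le> inverse (of_nat (Suc n)) / 2"
      by (rule of_rat_dense)
    define r where "r = inverse (real (Suc n))"
    have r: "r > 0" "r < e / 2" "dist x (of_rat q) \<le> r / 2"
      using n q by (simp_all add: r_def dist_padic_def)
    have "ball (of_rat q :: 'a padic) r \<subseteq> ball x e"
    proof
      fix y :: "'a padic" assume "y \<in> ball (of_rat q) r"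
      then show "y \<in> ball x e" using r dist_triangle[of x y "of_rat q"] by simp
    qed
    moreover have "x \<in> ball (of_rat q) r" using r by (simp add: dist_commute)
    ultimately show "\<exists>V\<in>B. x \<in> V \<and> V \<subseteq> U" using e by (auto simp: B_def r_def)
  qed
  moreover have "countable B" by (simp add: B_def)
  ultimately show "\<exists>B :: 'a padic set set. countable B \<and> open = generate_topology B"
    using topological_basis_imp_subbasis by blast
qed

lemma padic_ball_eq_cball: "padic_ball \<gamma> (c :: 'p::prime_card padic) = cball c (real CARD('p) powi \<gamma>)"
  by (auto simp: padic_ball_def dist_padic_def padic_norm_diff_commute)

lemma center_in_padic_ball [simp]: "c \<in> padic_ball \<gamma> c"
  by (simp add: padic_ball_def)

lemma padic_ball_cong:
  fixes x :: "'p::prime_card padic"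
  assumes "x \<in> padic_ball \<gamma> c"
  shows "padic_ball \<gamma> x = padic_ball \<gamma> c"
proof -
  have x: "padic_norm (x - c) \<le> real CARD('p) powi \<gamma>" using assms by (simp add: padic_ball_def)
  have "padic_norm (y - x) \<le> real CARD('p) powi \<gamma> \<longleftrightarrow> padic_norm (y - c) \<le> real CARD('p) powi \<gamma>" for y
    using padic_norm_add_le[OF _ x, of "y - x"] padic_norm_diff_le[OF _ x, of "y - c"] by auto
  then show ?thesis by (simp add: padic_ball_def)
qed

lemma padic_ball_mono: "\<gamma> \<le> \<gamma>' \<Longrightarrow> padic_ball \<gamma> (c :: 'p::prime_card padic) \<subseteq> padic_ball \<gamma>' c"
proof
  fix x assume "\<gamma> \<le> \<gamma>'" "x \<in> padic_ball \<gamma> c"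
  moreover have "real CARD('p) powi \<gamma> \<le> real CARD('p) powi \<gamma>'"
    using \<open>\<gamma> \<le> \<gamma>'\<close> by (intro power_int_increasing) auto
  ultimately show "x \<in> padic_ball \<gamma>' c" by (auto simp: padic_ball_def)
qed

lemma padic_ball_nested:
  assumes "\<gamma> \<le> \<gamma>'" "padic_ball \<gamma> (c :: 'p::prime_card padic) \<inter> padic_ball \<gamma>' c' \<noteq> {}"
  shows "padic_ball \<gamma> c \<subseteq> padic_ball \<gamma>' c'"
proof -
  obtain x where x: "x \<in> padic_ball \<gamma> c" "x \<in> padic_ball \<gamma>' c'" using assms by blast
  have "padic_ball \<gamma> c = padic_ball \<gamma> x" by (rule padic_ball_cong[OF x(1), symmetric])
  also have "\<dots> \<subseteq> padic_ball \<gamma>' x" by (rule padic_ball_mono[OF assms(1)])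
  also have "\<dots> = padic_ball \<gamma>' c'" by (rule padic_ball_cong[OF x(2)])
  finally show ?thesis .
qed

lemma open_padic_ball [simp]: "open (padic_ball \<gamma> (c :: 'p::prime_card padic))"
proof (rule openI)
  fix x assume "x \<in> padic_ball \<gamma> c"
  then have eq: "padic_ball \<gamma> x = padic_ball \<gamma> c" by (rule padic_ball_cong)
  have "ball x (real CARD('p) powi \<gamma>) \<subseteq> padic_ball \<gamma> c"
    unfolding eq[symmetric] unfolding padic_ball_eq_cball by (rule ball_subset_cball)
  then show "\<exists>e>0. ball x e \<subseteq> padic_ball \<gamma> c"
    by (intro exI[of _ "real CARD('p) powi \<gamma>"]) auto
qed

lemma padic_ball_borel [measurable, simp]: "padic_ball \<gamma> c \<in> sets borel"
  by (intro borel_open open_padic_ball)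

lemma padic_powi_small:
  assumes "e > 0"
  obtains n :: nat where "real CARD('p::prime_card) powi (- int n) < e"
  using real_arch_pow_inv[OF assms, of "inverse (real CARD('p))"] card_prime_gt_1[where 'p = 'p]
  by (auto simp: power_int_minus power_inverse inverse_less_1_iff)

lemma open_contains_padic_ball:
  fixes x :: "'p::prime_card padic"
  assumes "open U" "x \<in> U"
  obtains n where "n \<ge> k" "padic_ball (- int n) x \<subseteq> U"
proof -
  obtain e where e: "e > 0" "ball x e \<subseteq> U" using assms by (meson openE)
  obtain n where n: "real CARD('p) powi (- int n) < e" by (rule padic_powi_small[OF e(1)])
  have "padic_ball (- int (max k n)) x \<subseteq> padic_ball (- int n) x" by (intro padic_ball_mono) auto
  also have "\<dots> \<subseteq> U" using n e by (auto simp: padic_ball_eq_cball)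
  finally show ?thesis using that[of "max k n"] by simp
qed

lemma UN_padic_ball_eq_UNIV: "(\<Union>n. padic_ball (int n) (0 :: 'p::prime_card padic)) = UNIV"
proof -
  have "\<exists>n. x \<in> padic_ball (int n) 0" for x :: "'p padic"
  proof -
    obtain n where "padic_norm x \<le> real CARD('p) ^ n" by (rule padic_norm_bounded_power)
    then show ?thesis by (auto simp: padic_ball_def)
  qed
  then show ?thesis by auto
qed

lemma countable_padic_balls: "countable (range (padic_ball \<gamma> :: 'p::prime_card padic \<Rightarrow> _))"
proof -
  have "range (padic_ball \<gamma> :: 'p padic \<Rightarrow> _) \<subseteq> range (\<lambda>q. padic_ball \<gamma> (of_rat q))"
  proof safe
    fix x :: "'p padic"
    have "real CARD('p) powi \<gamma> > 0" by simp
    then obtain q where "padic_norm (x - of_rat q) \<le> real CARD('p) powi \<gamma>" by (rule of_rat_dense)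
    then have "padic_ball \<gamma> x = padic_ball \<gamma> (of_rat q)"
      by (intro padic_ball_cong) (simp add: padic_ball_def)
    then show "padic_ball \<gamma> x \<in> range (\<lambda>q. padic_ball \<gamma> (of_rat q))" by blast
  qed
  then show ?thesis by (rule countable_subset) simp
qed

text \<open>A measure that is finite on balls is determined by its values on balls, by this lemma and the next
  one.\<close>

lemma sigma_sets_padic_balls:
  "sets borel = sigma_sets UNIV (insert {} (range (\<lambda>(\<gamma>, c). padic_ball \<gamma> (c :: 'p::prime_card padic))))"
    (is "_ = sigma_sets UNIV ?E")
proof -
  have "sigma_sets UNIV {U. open U} = sigma_sets UNIV ?E"
  proof (rule sigma_sets_eqI)
    fix U :: "'p padic set" assume "U \<in> {U. open U}"
    then have "open U" by simp
    define C where "C = {B \<in> ?E. B \<subseteq> U}"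
    have "?E \<subseteq> insert {} (\<Union>\<gamma>. range (padic_ball \<gamma>))" by auto
    then have "countable ?E" by (rule countable_subset) (auto intro: countable_padic_balls)
    then have "countable C" unfolding C_def by (rule countable_subset[OF Collect_restrict])
    moreover have "U = \<Union>C"
    proof
      show "U \<subseteq> \<Union>C"
      proof
        fix x assume "x \<in> U"
        then obtain n where n: "padic_ball (- int n) x \<subseteq> U"
          by (rule open_contains_padic_ball[OF \<open>open U\<close>, of _ 0])
        have "padic_ball (- int n) x \<in> C"
          unfolding C_def using n by (auto intro: image_eqI[of _ _ "(- int n, x)"])
        then show "x \<in> \<Union>C" by (meson UnionI center_in_padic_ball)
      qed
    qed (auto simp: C_def)
    moreover have "\<Union>C \<in> sigma_sets UNIV ?E"
      by (rule sigma_sets_UNION[OF \<open>countable C\<close>]) (simp add: C_def sigma_sets.Basic)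
    ultimately show "U \<in> sigma_sets UNIV ?E" by (simp only:)
  next
    fix B assume "B \<in> ?E"
    then have "open B" by auto
    then show "B \<in> sigma_sets UNIV {U. open U}" by (auto intro: sigma_sets.Basic)
  qed
  then show ?thesis by (simp add: borel_def)
qed

lemma Int_stable_padic_balls:
  "Int_stable (insert {} (range (\<lambda>(\<gamma>, c). padic_ball \<gamma> (c :: 'p::prime_card padic))))"
proof (rule Int_stableI)
  fix A B :: "'p padic set"
  let ?E = "insert {} (range (\<lambda>(\<gamma>, c). padic_ball \<gamma> (c :: 'p padic)))"
  assume AB: "A \<in> ?E" "B \<in> ?E"
  show "A \<inter> B \<in> ?E"
  proof (cases "A \<inter> B = {}")
    case False
    then obtain g c g' c' where A: "A = padic_ball g c" and B: "B = padic_ball g' c'"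
      using AB by auto
    have "A \<subseteq> B \<or> B \<subseteq> A"
      using padic_ball_nested[of g g' c c'] padic_ball_nested[of g' g c' c] False
      unfolding A B by (cases "g \<le> g'") (auto simp: Int_commute)
    then show ?thesis using AB by (metis Int_absorb1 Int_absorb2)
  qed auto
qed

text \<open>A ball of radius \<open>p ^ k\<close> splits into \<open>p ^ n\<close> balls of radius \<open>p ^ (k - n)\<close>, one for each residue
  of the rescaled point modulo \<open>p ^ n\<close>.\<close>

lemma mem_padic_subball_iff:
  fixes x :: "'p::prime_card padic"
  shows "x \<in> padic_ball (k - int n) (c + of_nat a * unif powi (- k))
    \<longleftrightarrow> padic_norm (unif powi k * (x - c) - of_nat a) \<le> inverse (real CARD('p) ^ n)"
proof -
  have "unif powi k * (x - c) - of_nat a = unif powi k * (x - (c + of_nat a * unif powi (- k)))"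
    by (simp add: algebra_simps power_int_minus)
  then have "padic_norm (unif powi k * (x - c) - of_nat a)
      = inverse (real CARD('p)) powi k * padic_norm (x - (c + of_nat a * unif powi (- k)))"
    by (simp only: padic_norm_mult padic_norm_powi padic_norm_card)
  moreover have "t \<le> real CARD('p) powi (k - int n)
      \<longleftrightarrow> inverse (real CARD('p)) powi k * t \<le> inverse (real CARD('p) ^ n)" for t
    by (simp add: power_int_inverse power_int_diff field_simps)
  ultimately show ?thesis by (simp only: padic_ball_def mem_Collect_eq)
qed

lemma mem_padic_ball_iff_unit:
  fixes x :: "'p::prime_card padic"
  shows "x \<in> padic_ball k c \<longleftrightarrow> padic_norm (unif powi k * (x - c)) \<le> 1"
  using mem_padic_subball_iff[of x k 0 c 0] by simp

lemma padic_ball_split: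
  "padic_ball k c = (\<Union>a<CARD('p) ^ n.
     padic_ball (k - int n) (c + of_nat a * unif powi (- k :: int) :: 'p::prime_card padic))"
proof (intro equalityI subsetI)
  fix x assume "x \<in> padic_ball k c"
  then have "padic_norm (unif powi k * (x - c)) \<le> 1" by (simp only: mem_padic_ball_iff_unit)
  then obtain a where "a < CARD('p) ^ n"
    "padic_norm (unif powi k * (x - c) - of_nat a) \<le> inverse (real CARD('p) ^ n)"
    by (rule padic_int_residue)
  then show "x \<in> (\<Union>a<CARD('p) ^ n. padic_ball (k - int n) (c + of_nat a * unif powi (- k)))"
    unfolding UN_iff mem_padic_subball_iff by auto
next
  fix x assume "x \<in> (\<Union>a<CARD('p) ^ n. padic_ball (k - int n) (c + of_nat a * unif powi (- k)))"
  then obtain a where "padic_norm (unif powi k * (x - c) - of_nat a) \<le> inverse (real CARD('p) ^ n)"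
    unfolding UN_iff mem_padic_subball_iff by blast
  also have "\<dots> \<le> 1" by (simp add: inverse_le_1_iff)
  finally have "padic_norm ((unif powi k * (x - c) - of_nat a) + of_nat a) \<le> 1"
    by (intro padic_norm_add_le) auto
  then show "x \<in> padic_ball k c" by (simp add: mem_padic_ball_iff_unit)
qed

lemma disjoint_padic_subballs:
  "disjoint_family_on (\<lambda>a. padic_ball (k - int n) (c + of_nat a * unif powi (- k) :: 'p::prime_card padic))
     {..<CARD('p) ^ n}"
  unfolding disjoint_family_on_def
proof safe
  fix a b x assume ab: "a < CARD('p) ^ n" "b < CARD('p) ^ n" "a \<noteq> b"
    and "x \<in> padic_ball (k - int n) (c + of_nat a * unif powi (- k) :: 'p padic)"
    and "x \<in> padic_ball (k - int n) (c + of_nat b * unif powi (- k))"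
  then have "a = b"
    unfolding mem_padic_subball_iff using padic_int_residue_unique by blast
  then show "x \<in> {}" using ab by simp
qed

lemma continuous_on_locally_constant:
  fixes f :: "'p::prime_card padic \<Rightarrow> 'b::topological_space"
  assumes "locally_constant f"
  shows "continuous_on UNIV f"
proof (rule continuous_at_imp_continuous_on, safe)
  fix x
  obtain g where g: "\<And>y. y \<in> padic_ball g x \<Longrightarrow> f y = f x"
    using assms unfolding locally_constant_def by blast
  have "\<forall>\<^sub>F y in nhds x. y \<in> padic_ball g x"
    by (rule eventually_nhds_in_open) auto
  then have "\<forall>\<^sub>F y in nhds x. f y = f x" by eventually_elim (rule g)
  then have "(f \<longlongrightarrow> f x) (nhds x)" by (rule tendsto_eventually)
  then show "isCont f x" unfolding isCont_def by (rule tendsto_mono[rotated]) (simp add: at_within_def)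
qed

lemma locally_constant_padic_char: "locally_constant padic_char"
  unfolding locally_constant_def
proof (intro allI exI ballI)
  fix x y :: "'a padic" assume "y \<in> padic_ball 0 x"
  then have "padic_char (y - x) = 1" by (simp add: padic_ball_def padic_char_eq_1_iff)
  then show "padic_char y = padic_char x" using padic_char_add[of x "y - x"] by simp
qed

lemma continuous_on_padic_char:
  "continuous_on S f \<Longrightarrow> continuous_on S (\<lambda>x. padic_char (f x))"
  by (rule continuous_on_compose2[OF continuous_on_locally_constant[OF locally_constant_padic_char]]) auto

lemma borel_measurable_padic_char_mult:
  "(\<lambda>\<xi>. padic_char (\<xi> * y)) \<in> borel_measurable borel"
  by (intro borel_measurable_continuous_onI continuous_on_padic_char continuous_on_mult'
      continuous_on_id continuous_on_const)

section \<open>Haar measure\<close>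

text \<open>Haar measure on the Borel sets. Fubini's theorem is applied to this measure, because the product of
  two complete measures need not be complete; its completion has the same integrals.\<close>

locale borel_haar =
  fixes \<nu> :: "'p::prime_card padic measure"
  assumes sets_haar [measurable_cong, simp]: "sets \<nu> = sets borel"
    and distr_translation: "distr \<nu> borel ((+) a) = \<nu>"
    and emeasure_unit_ball: "emeasure \<nu> (padic_ball 0 0) = 1"
begin

lemma space_haar [simp]: "space \<nu> = UNIV"
  using sets_eq_imp_space_eq[OF sets_haar] by simp

lemma measurable_translation [measurable]: "(+) a \<in> borel_measurable (borel :: 'p padic measure)"
  by (intro borel_measurable_continuous_onI continuous_intros)

lemma emeasure_translation:
  assumes "A \<in> sets borel"
  shows "emeasure \<nu> ((+) a -` A) = emeasure \<nu> A"
proof -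
  have "emeasure (distr \<nu> borel ((+) a)) A = emeasure \<nu> ((+) a -` A \<inter> space \<nu>)"
    using assms by (intro emeasure_distr) auto
  then show ?thesis by (simp add: distr_translation)
qed

lemma integral_translation:
  fixes f :: "'p padic \<Rightarrow> complex"
  assumes "f \<in> borel_measurable borel"
  shows "(\<integral>x. f (a + x) \<partial>\<nu>) = (\<integral>x. f x \<partial>\<nu>)"
proof -
  have "integral\<^sup>L (distr \<nu> borel ((+) a)) f = (\<integral>x. f (a + x) \<partial>\<nu>)"
    using assms by (intro integral_distr) auto
  then show ?thesis by (simp add: distr_translation)
qed

lemma emeasure_ball_split:
  "emeasure \<nu> (padic_ball k c) = of_nat (CARD('p) ^ n) * emeasure \<nu> (padic_ball (k - int n) 0)"
proof -
  let ?B = "\<lambda>a. padic_ball (k - int n) (c + of_nat a * unif powi (- k) :: 'p padic)"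
  have "(+) (- b) -` padic_ball \<gamma> 0 = padic_ball \<gamma> b" for \<gamma> and b :: "'p padic"
    by (auto simp: padic_ball_def)
  then have "emeasure \<nu> (padic_ball \<gamma> b) = emeasure \<nu> (padic_ball \<gamma> 0)" for \<gamma> b
    using emeasure_translation[of "padic_ball \<gamma> 0" "- b"] by simp
  note centered = this
  have "emeasure \<nu> (padic_ball k c) = (\<Sum>a<CARD('p) ^ n. emeasure \<nu> (?B a))"
    unfolding padic_ball_split[of k c n]
    by (intro sum_emeasure[symmetric] disjoint_padic_subballs) auto
  also have "\<dots> = (\<Sum>a<CARD('p) ^ n. emeasure \<nu> (padic_ball (k - int n) 0))"
    by (intro sum.cong refl centered)
  finally show ?thesis by simp
qed

text \<open>Splitting relates the measures of balls of different radii, and the unit ball has measure \<open>1\<close>.\<close>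

lemma emeasure_padic_ball: "emeasure \<nu> (padic_ball \<gamma> c) = ennreal (real CARD('p) powi \<gamma>)"
proof (cases "\<gamma> \<ge> 0")
  case True
  then have "emeasure \<nu> (padic_ball \<gamma> c) = of_nat (CARD('p) ^ nat \<gamma>)"
    using emeasure_ball_split[of \<gamma> c "nat \<gamma>"] by (simp add: emeasure_unit_ball)
  also have "\<dots> = ennreal (real (CARD('p) ^ nat \<gamma>))" by (rule ennreal_of_nat_eq_real_of_nat)
  finally show ?thesis using True by (simp add: power_int_def)
next
  case False
  define n where "n = nat (- \<gamma>)"
  have g: "\<gamma> = - int n" using False by (simp add: n_def)
  have 1: "1 = of_nat (CARD('p) ^ n) * emeasure \<nu> (padic_ball \<gamma> 0)"
    using emeasure_ball_split[of 0 0 n] emeasure_unit_ball by (simp add: g)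
  have "emeasure \<nu> (padic_ball \<gamma> c) = emeasure \<nu> (padic_ball \<gamma> 0)"
    using emeasure_ball_split[of \<gamma> c 0] by simp
  moreover have "emeasure \<nu> (padic_ball \<gamma> 0) = ennreal (real CARD('p) powi \<gamma>)"
  proof (cases "emeasure \<nu> (padic_ball \<gamma> 0)")
    case (real r)
    then have "ennreal 1 = ennreal (real (CARD('p) ^ n) * r)"
      using 1
      by (simp only: real ennreal_of_nat_eq_real_of_nat ennreal_mult[symmetric] of_nat_0_le_iff ennreal_1)
    then have "1 = real (CARD('p) ^ n) * r"
      using real(1) by (subst (asm) ennreal_inj) auto
    then have "r = real CARD('p) powi \<gamma>" by (simp add: g power_int_minus field_simps)
    then show ?thesis using real by simp
  next
    case top
    then show ?thesis using 1 by (simp add: ennreal_mult_top)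
  qed
  ultimately show ?thesis by simp
qed

lemma measure_padic_ball: "measure \<nu> (padic_ball \<gamma> c) = real CARD('p) powi \<gamma>"
  by (simp add: measure_def emeasure_padic_ball)

lemma padic_ball_fmeasurable: "padic_ball \<gamma> c \<in> fmeasurable \<nu>"
  by (intro fmeasurableI) (auto simp: emeasure_padic_ball)

sublocale sigma_finite_measure \<nu>
proof
  show "\<exists>A. countable A \<and> A \<subseteq> sets \<nu> \<and> \<Union> A = space \<nu> \<and> (\<forall>a\<in>A. emeasure \<nu> a \<noteq> \<infinity>)"
    by (intro exI[of _ "range (\<lambda>n. padic_ball (int n) 0)"])
      (auto simp: emeasure_padic_ball UN_padic_ball_eq_UNIV)
qed

text \<open>The exceptional set is open, and nonempty open sets have positive measure.\<close>

lemma AE_locally_constant_imp: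
  assumes P: "locally_constant (P :: 'p padic \<Rightarrow> bool)" and "AE x in \<nu>. P x"
  shows "P x"
proof (rule ccontr)
  assume "\<not> P x"
  obtain g where g: "\<And>y. y \<in> padic_ball g x \<Longrightarrow> P y = P x"
    using P unfolding locally_constant_def by blast
  have "AE y in \<nu>. y \<notin> padic_ball g x"
    using assms(2) by eventually_elim (use g \<open>\<not> P x\<close> in blast)
  then have "padic_ball g x \<in> null_sets \<nu>" by (subst AE_iff_null_sets) auto
  then have "ennreal (real CARD('p) powi g) = 0" by (simp add: null_sets_def emeasure_padic_ball)
  then show False by simp
qed

section \<open>Fourier analysis\<close>

lemma indicator_complex: "(indicator A x :: complex) = complex_of_real (indicator A x)"
  by (simp add: indicator_def)

lemma integrable_indicator_complex:
  "A \<in> fmeasurable \<nu> \<Longrightarrow> integrable \<nu> (indicator A :: _ \<Rightarrow> complex)"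
  unfolding indicator_complex[abs_def]
  by (intro integrable_of_real integrable_real_indicator) (auto simp: fmeasurable_def)

lemma integral_indicator_complex:
  "A \<in> sets borel \<Longrightarrow> (\<integral>x. indicator A x \<partial>\<nu>) = complex_of_real (measure \<nu> A)"
  unfolding indicator_complex[abs_def] by simp

text \<open>The factor \<open>padic_char (h * z)\<close> that translation by \<open>h\<close> produces is not \<open>1\<close> for a suitable
  \<open>h\<close> in the ball, unless \<open>z\<close> is small; then the integral has to vanish.\<close>

lemma integral_padic_char_ball:
  "(\<integral>\<xi>. indicator (padic_ball k 0) \<xi> * padic_char (\<xi> * z) \<partial>\<nu>)
    = of_real (real CARD('p) powi k) * indicator (padic_ball (- k) 0) z"
proof (cases "z \<in> padic_ball (- k) 0")
  case True
  then have z: "padic_norm z \<le> real CARD('p) powi (- k)" by (simp add: padic_ball_def)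
  have "indicator (padic_ball k 0) \<xi> * padic_char (\<xi> * z) = indicator (padic_ball k 0) \<xi>" for \<xi>
  proof (cases "\<xi> \<in> padic_ball k 0")
    case True
    then have "padic_norm (\<xi> * z) \<le> real CARD('p) powi k * real CARD('p) powi (- k)"
      unfolding padic_norm_mult using z by (intro mult_mono) (auto simp: padic_ball_def)
    then have "padic_char (\<xi> * z) = 1" by (simp add: padic_char_eq_1_iff power_int_minus)
    then show ?thesis by simp
  qed auto
  then have "(\<integral>\<xi>. indicator (padic_ball k 0) \<xi> * padic_char (\<xi> * z) \<partial>\<nu>)
      = (\<integral>\<xi>. indicator (padic_ball k 0) \<xi> \<partial>\<nu>)" by (simp only:)
  then show ?thesis using True by (simp add: integral_indicator_complex measure_padic_ball)
next
  case False
  \<comment> \<open>an element of the ball of largest absolute value, so that \<open>h * z\<close> is not integral\<close>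
  define h :: "'p padic" where "h = unif powi (- k)"
  let ?f = "\<lambda>\<xi>. indicator (padic_ball k 0) \<xi> * padic_char (\<xi> * z)"
  have h: "padic_norm h = real CARD('p) powi k"
    by (simp add: h_def power_int_minus power_int_inverse)
  have "padic_norm z > real CARD('p) powi (- k)" using False by (simp add: padic_ball_def)
  then have "real CARD('p) powi k * padic_norm z > real CARD('p) powi k * real CARD('p) powi (- k)"
    by (intro mult_strict_left_mono) auto
  then have "padic_norm (h * z) > 1" by (simp add: h power_int_minus)
  then have ne: "padic_char (h * z) \<noteq> 1" by (simp add: padic_char_eq_1_iff)
  have "h \<in> padic_ball k 0" by (simp add: padic_ball_def h)
  then have "h + \<xi> \<in> padic_ball k 0 \<longleftrightarrow> \<xi> \<in> padic_ball k 0" for \<xi>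
    using padic_norm_add_le[of h "real CARD('p) powi k" \<xi>]
      padic_norm_diff_le[of "h + \<xi>" "real CARD('p) powi k" h] by (auto simp: padic_ball_def)
  then have "?f (h + \<xi>) = padic_char (h * z) * ?f \<xi>" for \<xi>
    by (simp add: ring_distribs padic_char_add indicator_def)
  moreover have "(\<integral>\<xi>. ?f (h + \<xi>) \<partial>\<nu>) = (\<integral>\<xi>. ?f \<xi> \<partial>\<nu>)"
  proof (rule integral_translation)
    show "?f \<in> borel_measurable borel"
      by (intro borel_measurable_times borel_measurable_indicator borel_measurable_padic_char_mult) simp
  qed
  ultimately have "padic_char (h * z) * (\<integral>\<xi>. ?f \<xi> \<partial>\<nu>) = (\<integral>\<xi>. ?f \<xi> \<partial>\<nu>)" by simp
  then have "(\<integral>\<xi>. ?f \<xi> \<partial>\<nu>) = 0" using ne by simp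
  then show ?thesis using False by simp
qed

lemma norm_inv_fourier_le:
  "norm (inv_fourier \<nu> f \<xi>) \<le> (\<integral>x. norm (f x) \<partial>\<nu>)"
  using integral_norm_bound[of \<nu> "\<lambda>x. padic_char (- (\<xi> * x)) * f x"]
  by (simp add: inv_fourier_def norm_mult)

text \<open>Both sides are the integral of \<open>padic_char (- (\<xi> * x)) * f x * g \<xi>\<close> over the square.\<close>

lemma inv_fourier_multiplication:
  assumes f: "integrable \<nu> f" and g: "integrable \<nu> g"
  shows "(\<integral>\<xi>. g \<xi> * inv_fourier \<nu> f \<xi> \<partial>\<nu>) = (\<integral>x. f x * inv_fourier \<nu> g x \<partial>\<nu>)"
proof -
  interpret pair_sigma_finite \<nu> \<nu> ..
  let ?F = "\<lambda>x \<xi>. padic_char (- (\<xi> * x)) * f x * g \<xi>"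
  have [measurable]: "f \<in> borel_measurable borel" "g \<in> borel_measurable borel"
    using borel_measurable_integrable[OF f] borel_measurable_integrable[OF g]
      measurable_cong_sets[OF sets_haar refl] by auto
  have [measurable]: "(\<lambda>z. padic_char (- (snd z * fst z))) \<in> borel_measurable (\<nu> \<Otimes>\<^sub>M \<nu>)"
    by (rule borel_measurable_continuous_Pair[where H = "\<lambda>x y. padic_char (- (y * x))"])
      (auto intro!: continuous_on_padic_char continuous_on_minus continuous_on_mult'
          continuous_on_fst continuous_on_snd continuous_on_id)
  have "integrable (\<nu> \<Otimes>\<^sub>M \<nu>) (\<lambda>z. ?F (fst z) (snd z))"
  proof (rule Fubini_integrable)
    show "integrable \<nu> (\<lambda>x. \<integral>\<xi>. norm (?F (fst (x, \<xi>)) (snd (x, \<xi>))) \<partial>\<nu>)"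
      using f by (simp add: norm_mult)
    have "integrable \<nu> (\<lambda>\<xi>. ?F x \<xi>)" for x
    proof (rule Bochner_Integration.integrable_bound)
      show "integrable \<nu> (\<lambda>\<xi>. f x * g \<xi>)" using g by simp
      show "(\<lambda>\<xi>. ?F x \<xi>) \<in> borel_measurable \<nu>"
        using borel_measurable_padic_char_mult[of "- x"] by simp
    qed (simp add: norm_mult)
    then show "AE x in \<nu>. integrable \<nu> (\<lambda>\<xi>. ?F (fst (x, \<xi>)) (snd (x, \<xi>)))" by simp
  qed measurable
  then have "(\<integral>\<xi>. (\<integral>x. ?F x \<xi> \<partial>\<nu>) \<partial>\<nu>) = (\<integral>x. (\<integral>\<xi>. ?F x \<xi> \<partial>\<nu>) \<partial>\<nu>)"
    by (intro Fubini_integral) (simp add: case_prod_unfold)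
  moreover have "(\<integral>x. ?F x \<xi> \<partial>\<nu>) = g \<xi> * inv_fourier \<nu> f \<xi>" for \<xi>
    by (simp add: inv_fourier_def mult.commute)
  moreover have "(\<integral>\<xi>. ?F x \<xi> \<partial>\<nu>) = f x * inv_fourier \<nu> g x" for x
  proof -
    have "(\<integral>\<xi>. ?F x \<xi> \<partial>\<nu>) = (\<integral>\<xi>. f x * (padic_char (- (x * \<xi>)) * g \<xi>) \<partial>\<nu>)"
      by (intro Bochner_Integration.integral_cong refl) (simp add: mult_ac)
    then show ?thesis by (simp add: inv_fourier_def)
  qed
  ultimately show ?thesis by (simp only:)
qed

text \<open>Fourier inversion before passing to the limit: the transform of the indicator function of a large
  ball is a multiple of that of a small ball, so convolution with it averages over small balls.\<close>

lemma integral_inv_fourier_ball: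
  assumes E: "E \<in> fmeasurable \<nu>"
  shows "(\<integral>\<xi>. indicator (padic_ball k 0) \<xi> * padic_char (\<xi> * y) * inv_fourier \<nu> (indicator E) \<xi> \<partial>\<nu>)
    = of_real (real CARD('p) powi k * measure \<nu> (E \<inter> padic_ball (- k) y))"
proof -
  let ?g = "\<lambda>\<xi>. indicator (padic_ball k 0) \<xi> * padic_char (\<xi> * y)"
  have [measurable]: "E \<in> sets borel" using E by (simp add: fmeasurable_def)
  have "integrable \<nu> ?g"
  proof (rule Bochner_Integration.integrable_bound)
    show "integrable \<nu> (indicator (padic_ball k 0) :: _ \<Rightarrow> complex)"
      by (intro integrable_indicator_complex padic_ball_fmeasurable)
    show "?g \<in> borel_measurable \<nu>" using borel_measurable_padic_char_mult[of y] by simp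
  qed (simp add: norm_mult)
  then have "(\<integral>\<xi>. ?g \<xi> * inv_fourier \<nu> (indicator E) \<xi> \<partial>\<nu>) = (\<integral>x. indicator E x * inv_fourier \<nu> ?g x \<partial>\<nu>)"
    by (intro inv_fourier_multiplication integrable_indicator_complex E)
  also have "inv_fourier \<nu> ?g x = of_real (real CARD('p) powi k) * indicator (padic_ball (- k) y) x" for x
  proof -
    have "padic_char (- (x * \<xi>)) * ?g \<xi> = indicator (padic_ball k 0) \<xi> * padic_char (\<xi> * (y - x))" for \<xi>
      using padic_char_add[of "- (x * \<xi>)" "\<xi> * y"] by (simp add: algebra_simps)
    then have "inv_fourier \<nu> ?g x = of_real (real CARD('p) powi k) * indicator (padic_ball (- k) 0) (y - x)"
      by (simp only: inv_fourier_def integral_padic_char_ball)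
    also have "indicator (padic_ball (- k) 0) (y - x) = (indicator (padic_ball (- k) y) x :: complex)"
      by (simp add: indicator_def padic_ball_def padic_norm_diff_commute)
    finally show ?thesis .
  qed
  then have "(\<integral>x. indicator E x * inv_fourier \<nu> ?g x \<partial>\<nu>)
      = (\<integral>x. of_real (real CARD('p) powi k) * indicator (E \<inter> padic_ball (- k) y) x \<partial>\<nu>)"
    by (intro Bochner_Integration.integral_cong refl) (simp add: indicator_def)
  also have "\<dots> = of_real (real CARD('p) powi k * measure \<nu> (E \<inter> padic_ball (- k) y))"
    by (simp add: integral_indicator_complex)
  finally show ?thesis .
qed

end

section \<open>Sets whose indicator function is band-limited\<close>

text \<open>The transform of \<open>\<one>\<^sub>E\<close> is compactly supported, as in signal analysis; on the p-adic side this means that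
  \<open>\<one>\<^sub>E\<close> is locally constant at scale \<open>p ^ (- N)\<close> after a change on a null set.\<close>

locale band_limited_set = borel_haar \<nu> for \<nu> :: "'p::prime_card padic measure" +
  fixes E :: "'p padic set" and N :: int
  assumes E_fmeasurable: "E \<in> fmeasurable \<nu>"
    and band_limit: "\<And>\<xi>. \<xi> \<notin> padic_ball N 0 \<Longrightarrow> inv_fourier \<nu> (indicator E) \<xi> = 0"
begin

abbreviation \<phi> :: "'p padic \<Rightarrow> complex" where
  "\<phi> \<equiv> inv_fourier \<nu> (indicator E)"

lemma E_borel [measurable, simp]: "E \<in> sets borel"
  using E_fmeasurable by (simp add: fmeasurable_def)

lemma E_Int_fmeasurable: "A \<in> sets borel \<Longrightarrow> E \<inter> A \<in> fmeasurable \<nu>"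
  using fmeasurable_Int_fmeasurable[OF E_fmeasurable] by simp

text \<open>The mean value of \<open>\<one>\<^sub>E\<close> over the ball of radius \<open>p ^ (- N)\<close> around \<open>y\<close>.\<close>

definition local_density :: "'p padic \<Rightarrow> real" where
  "local_density y = real CARD('p) powi N * measure \<nu> (E \<inter> padic_ball (- N) y)"

lemma fourier_inversion_ball:
  assumes "k \<ge> N"
  shows "(\<integral>\<xi>. padic_char (\<xi> * y) * \<phi> \<xi> \<partial>\<nu>)
    = of_real (real CARD('p) powi k * measure \<nu> (E \<inter> padic_ball (- k) y))"
proof -
  have "padic_char (\<xi> * y) * \<phi> \<xi> = indicator (padic_ball k 0) \<xi> * padic_char (\<xi> * y) * \<phi> \<xi>" for \<xi>
    using band_limit[of \<xi>] padic_ball_mono[OF assms, of 0] by (auto simp: indicator_def)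
  then show ?thesis using integral_inv_fourier_ball[OF E_fmeasurable, of k y] by (simp only:)
qed

lemma fourier_inversion: "(\<integral>\<xi>. padic_char (\<xi> * y) * \<phi> \<xi> \<partial>\<nu>) = of_real (local_density y)"
  using fourier_inversion_ball[of N y] by (simp add: local_density_def)

text \<open>The left side of Fourier inversion does not depend on \<open>k\<close>, so the mean density over smaller balls
  is the same as at scale \<open>p ^ (- N)\<close>.\<close>

lemma measure_Int_small_ball:
  assumes "k \<ge> N"
  shows "measure \<nu> (E \<inter> padic_ball (- k) y) = local_density y * real CARD('p) powi (- k)"
proof -
  have "real CARD('p) powi k * measure \<nu> (E \<inter> padic_ball (- k) y) = local_density y"
    using fourier_inversion[of y] fourier_inversion_ball[OF assms, of y] of_real_eq_iff by metis
  then show ?thesis by (simp add: power_int_minus field_simps)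
qed

lemma local_density_cong: "x \<in> padic_ball (- N) y \<Longrightarrow> local_density x = local_density y"
  by (simp add: local_density_def padic_ball_cong)

lemma local_density_nonneg: "local_density y \<ge> 0"
  by (simp add: local_density_def)

text \<open>Both sides are finite measures in \<open>A\<close>. A ball \<open>A\<close> is disjoint from the fixed ball, contains it, or is
  contained in it; in the last case the densities agree by the previous lemmas.\<close>

lemma emeasure_Int_borel:
  assumes A: "A \<in> sets borel"
  shows "emeasure \<nu> (E \<inter> padic_ball (- N) y \<inter> A)
    = ennreal (local_density y) * emeasure \<nu> (padic_ball (- N) y \<inter> A)"
proof -
  let ?B = "padic_ball (- N) y" and ?c = "local_density y"
  let ?M1 = "density \<nu> (indicator (E \<inter> ?B))" and ?M2 = "density \<nu> (\<lambda>x. ennreal ?c * indicator ?B x)"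
  let ?G = "insert {} (range (\<lambda>(\<gamma>, c). padic_ball \<gamma> (c :: 'p padic)))"
  have M1: "emeasure ?M1 A = emeasure \<nu> (E \<inter> ?B \<inter> A)" if "A \<in> sets borel" for A
  proof -
    have "emeasure ?M1 A = (\<integral>\<^sup>+x. indicator (E \<inter> ?B) x * indicator A x \<partial>\<nu>)"
      using that by (intro emeasure_density) auto
    also have "\<dots> = (\<integral>\<^sup>+x. indicator (E \<inter> ?B \<inter> A) x \<partial>\<nu>)"
      by (intro nn_integral_cong) (simp add: indicator_def)
    finally show ?thesis using that by simp
  qed
  have M2: "emeasure ?M2 A = ennreal ?c * emeasure \<nu> (?B \<inter> A)" if "A \<in> sets borel" for A
  proof -
    have "emeasure ?M2 A = (\<integral>\<^sup>+x. ennreal ?c * indicator ?B x * indicator A x \<partial>\<nu>)"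
      using that by (intro emeasure_density) auto
    also have "\<dots> = (\<integral>\<^sup>+x. ennreal ?c * indicator (?B \<inter> A) x \<partial>\<nu>)"
      by (intro nn_integral_cong) (simp add: indicator_def)
    finally show ?thesis using that by (simp add: nn_integral_cmult_indicator)
  qed
  have small: "emeasure \<nu> (E \<inter> padic_ball (- k) z) = ennreal ?c * emeasure \<nu> (padic_ball (- k) z)"
    if "k \<ge> N" "z \<in> ?B" for k z
  proof -
    have "emeasure \<nu> (E \<inter> padic_ball (- k) z) = ennreal (measure \<nu> (E \<inter> padic_ball (- k) z))"
      using E_Int_fmeasurable[of "padic_ball (- k) z"] by (intro emeasure_eq_measure2) auto
    also have "measure \<nu> (E \<inter> padic_ball (- k) z) = ?c * real CARD('p) powi (- k)"
      using measure_Int_small_ball[OF that(1), of z] local_density_cong[OF that(2)] by simp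
    finally show ?thesis
      by (simp add: emeasure_padic_ball ennreal_mult local_density_nonneg)
  qed
  have "?M1 = ?M2"
  proof (rule measure_eqI_generator_eq[OF Int_stable_padic_balls])
    show "?G \<subseteq> Pow UNIV" by simp
    show "sets ?M1 = sigma_sets UNIV ?G" "sets ?M2 = sigma_sets UNIV ?G"
      by (simp_all add: sigma_sets_padic_balls)
    show "range (\<lambda>n. padic_ball (int n) (0 :: 'p padic)) \<subseteq> ?G"
      by (auto intro: image_eqI[of _ _ "(int n, 0)" for n])
    show "(\<Union>n. padic_ball (int n) (0 :: 'p padic)) = UNIV" by (rule UN_padic_ball_eq_UNIV)
    show "emeasure ?M1 (padic_ball (int n) 0) \<noteq> \<infinity>" for n
    proof -
      have "emeasure \<nu> (E \<inter> ?B \<inter> padic_ball (int n) 0) \<le> emeasure \<nu> ?B"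
        by (intro emeasure_mono) auto
      also have "\<dots> < \<infinity>" by (simp add: emeasure_padic_ball)
      finally show ?thesis by (simp add: M1)
    qed
    fix X assume "X \<in> ?G"
    then consider "X = {}" | k c where "X = padic_ball (- k) c"
      by auto (metis minus_minus)
    then show "emeasure ?M1 X = emeasure ?M2 X"
    proof cases
      case 1
      then show ?thesis by simp
    next
      case (2 k c)
      have X: "X \<in> sets borel" by (simp add: 2)
      show ?thesis
      proof (cases "?B \<inter> X = {}")
        case True
        then have "E \<inter> ?B \<inter> X = {}" by blast
        then show ?thesis using True by (simp add: M1 M2 X)
      next
        case False
        show ?thesis
        proof (cases "N \<le> k")
          case True
          then have sub: "X \<subseteq> ?B"
            using False unfolding 2 by (intro padic_ball_nested) (auto simp: Int_commute)
          then have "E \<inter> ?B \<inter> X = E \<inter> X" "?B \<inter> X = X" "c \<in> ?B" by (auto simp: 2)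
          then show ?thesis using small[OF True, of c] by (simp add: M1 M2 X) (simp add: 2)
        next
          case F: False
          then have "?B \<subseteq> X" using False unfolding 2 by (intro padic_ball_nested) auto
          then have "E \<inter> ?B \<inter> X = E \<inter> ?B" "?B \<inter> X = ?B" by auto
          then show ?thesis using small[of N y] by (simp add: M1 M2 X)
        qed
      qed
    qed
  qed
  then show ?thesis using M1[OF A] M2[OF A] by simp
qed

text \<open>On a ball of radius \<open>p ^ (- N)\<close> the set is independent of every measurable set, hence of
  itself, and so its density \<open>c\<close> there satisfies \<open>c = c * c\<close>.\<close>

lemma local_density_0_or_1: "local_density y = 0 \<or> local_density y = 1"
proof -
  let ?B = "padic_ball (- N) y" and ?c = "local_density y"
  let ?m = "measure \<nu> (E \<inter> ?B)"
  have em: "emeasure \<nu> (E \<inter> ?B) = ennreal ?m"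
    using E_Int_fmeasurable[of ?B] by (intro emeasure_eq_measure2) auto
  have "emeasure \<nu> (E \<inter> ?B) = ennreal ?c * emeasure \<nu> (E \<inter> ?B)"
    using emeasure_Int_borel[of E y] by (simp add: Int_ac)
  then have "?m = ?c * ?m"
    unfolding em by (simp add: ennreal_mult[symmetric] local_density_nonneg)
  moreover have "?m = ?c * real CARD('p) powi (- N)" by (rule measure_Int_small_ball) simp
  ultimately show ?thesis by simp
qed

definition smooth_version :: "'p padic set" where
  "smooth_version = {y. local_density y = 1}"

lemma padic_ball_subset_smooth_version:
  assumes "y \<in> smooth_version"
  shows "padic_ball (- N) y \<subseteq> smooth_version"
  using assms local_density_cong by (auto simp: smooth_version_def)

lemma locally_constant_smooth_version: "locally_constant (indicator smooth_version :: _ \<Rightarrow> complex)"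
  unfolding locally_constant_def
  by (intro allI exI[of _ "- N"]) (auto simp: indicator_def smooth_version_def local_density_cong)

lemma smooth_version_borel [simp]: "smooth_version \<in> sets borel"
proof -
  have "smooth_version = (\<Union>y\<in>smooth_version. padic_ball (- N) y)"
    using padic_ball_subset_smooth_version by auto
  moreover have "open (\<Union>y\<in>smooth_version. padic_ball (- N) y)" by auto
  ultimately show ?thesis by (metis borel_open)
qed

text \<open>In a ball of radius \<open>p ^ (- N)\<close> the density is \<open>0\<close> or \<open>1\<close>, so one of the set and its complement is
  null there. Countably many such balls cover the field.\<close>

lemma AE_smooth_version: "AE x in \<nu>. x \<in> smooth_version \<longleftrightarrow> x \<in> E"
proof -
  have "AE x in \<nu>. x \<in> B \<longrightarrow> (x \<in> smooth_version \<longleftrightarrow> x \<in> E)"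
    if "B \<in> range (padic_ball (- N))" for B
  proof -
    from that obtain y where B: "B = padic_ball (- N) y" by blast
    have Bs: "B \<in> sets borel" by (simp add: B)
    have dens: "x \<in> smooth_version \<longleftrightarrow> local_density y = 1" if "x \<in> B" for x
      using local_density_cong[of x y] that by (simp add: smooth_version_def B)
    have m: "measure \<nu> (E \<inter> B) = local_density y * measure \<nu> B"
      unfolding B measure_padic_ball by (rule measure_Int_small_ball) simp
    consider "local_density y = 0" | "local_density y = 1" using local_density_0_or_1 by blast
    then show ?thesis
    proof cases
      case 1
      have "emeasure \<nu> (E \<inter> B) = ennreal (measure \<nu> (E \<inter> B))"
        using E_Int_fmeasurable[OF Bs] by (intro emeasure_eq_measure2) auto
      then have "E \<inter> B \<in> null_sets \<nu>" using m 1 Bs by (auto intro: null_setsI)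
      then have "AE x in \<nu>. x \<notin> E \<inter> B" by (rule AE_not_in)
      then show ?thesis by eventually_elim (use dens 1 in auto)
    next
      case 2
      have fm: "B \<in> fmeasurable \<nu>" "E \<inter> B \<in> fmeasurable \<nu>"
        using padic_ball_fmeasurable E_Int_fmeasurable[OF Bs] by (auto simp: B)
      have "B - E = B - E \<inter> B" by blast
      then have "measure \<nu> (B - E) = measure \<nu> B - measure \<nu> (E \<inter> B)"
        using measurable_measure_Diff[OF fm(1), of "E \<inter> B"] fm(2) Bs by simp
      moreover have "B - E \<in> fmeasurable \<nu>" using fm by (intro fmeasurable_Diff) auto
      then have "emeasure \<nu> (B - E) = ennreal (measure \<nu> (B - E))"
        by (intro emeasure_eq_measure2)
      ultimately have "B - E \<in> null_sets \<nu>" using m 2 Bs by (auto intro: null_setsI)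
      then have "AE x in \<nu>. x \<notin> B - E" by (rule AE_not_in)
      then show ?thesis by eventually_elim (use dens 2 in auto)
    qed
  qed
  then have "AE x in \<nu>. \<forall>B\<in>range (padic_ball (- N)). x \<in> B \<longrightarrow> (x \<in> smooth_version \<longleftrightarrow> x \<in> E)"
    by (intro AE_ball_countable' countable_padic_balls)
  then show ?thesis by eventually_elim (meson center_in_padic_ball rangeI)
qed

text \<open>By Fourier inversion, a period \<open>h\<close> of the transform makes the local density at \<open>y\<close> invariant under
  multiplication by \<open>padic_char (h * y)\<close>. Where this is not \<open>1\<close>, the density vanishes.\<close>

lemma smooth_version_subset_ball:
  assumes per: "\<And>\<xi>. \<phi> (\<xi> + unif powi M) = \<phi> \<xi>" and meas: "\<phi> \<in> borel_measurable borel"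
  shows "smooth_version \<subseteq> padic_ball M 0"
proof (rule ccontr)
  assume "\<not> ?thesis"
  then obtain y where y: "local_density y = 1" "y \<notin> padic_ball M 0"
    by (auto simp: smooth_version_def)
  define h :: "'p padic" where "h = unif powi M"
  let ?f = "\<lambda>\<xi>. padic_char (\<xi> * y) * \<phi> \<xi>"
  have "real CARD('p) powi (- M) * padic_norm y > real CARD('p) powi (- M) * real CARD('p) powi M"
    using y by (intro mult_strict_left_mono) (auto simp: padic_ball_def)
  then have "padic_norm (h * y) > 1" by (simp add: h_def power_int_minus power_int_inverse)
  then have ne: "padic_char (h * y) \<noteq> 1" by (simp add: padic_char_eq_1_iff)
  have "?f (h + \<xi>) = padic_char (h * y) * ?f \<xi>" for \<xi>
    using per[of \<xi>] by (simp add: ring_distribs padic_char_add h_def add.commute)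
  moreover have "(\<integral>\<xi>. ?f (h + \<xi>) \<partial>\<nu>) = (\<integral>\<xi>. ?f \<xi> \<partial>\<nu>)"
  proof (rule integral_translation)
    show "?f \<in> borel_measurable borel"
      by (intro borel_measurable_times borel_measurable_padic_char_mult meas)
  qed
  ultimately have "padic_char (h * y) * (\<integral>\<xi>. ?f \<xi> \<partial>\<nu>) = (\<integral>\<xi>. ?f \<xi> \<partial>\<nu>)" by simp
  then show False using ne by (simp add: fourier_inversion y)
qed

lemma integrable_transform:
  assumes "\<phi> \<in> borel_measurable borel"
  shows "integrable \<nu> \<phi>"
proof (rule Bochner_Integration.integrable_bound)
  let ?C = "\<integral>x. norm (indicator E x :: complex) \<partial>\<nu>"
  show "integrable \<nu> (\<lambda>\<xi>. of_real ?C * indicator (padic_ball N 0) \<xi> :: complex)"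
    by (intro integrable_mult_right integrable_indicator_complex padic_ball_fmeasurable)
  show "\<phi> \<in> borel_measurable \<nu>" using assms by simp
  have "norm (\<phi> \<xi>) \<le> norm (of_real ?C * indicator (padic_ball N 0) \<xi> :: complex)" for \<xi>
    using norm_inv_fourier_le[of "indicator E" \<xi>] band_limit[of \<xi>]
    by (cases "\<xi> \<in> padic_ball N 0") auto
  then show "AE \<xi> in \<nu>. norm (\<phi> \<xi>) \<le> norm (of_real ?C * indicator (padic_ball N 0) \<xi> :: complex)"
    by simp
qed

text \<open>Plancherel's theorem for \<open>\<one>\<^sub>E\<close>: by the multiplication formula and Fourier inversion the
  squared norm of the transform is the integral of the local density over \<open>E\<close>.\<close>

lemma plancherel:
  assumes meas: "\<phi> \<in> borel_measurable borel"
  shows "(\<integral>\<xi>. \<phi> \<xi> * cnj (\<phi> \<xi>) \<partial>\<nu>) = of_real (measure \<nu> E)"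
proof -
  have int: "integrable \<nu> (\<lambda>\<xi>. cnj (\<phi> \<xi>))" using integrable_transform[OF meas] by simp
  have "inv_fourier \<nu> (\<lambda>\<xi>. cnj (\<phi> \<xi>)) x = of_real (local_density x)" for x
  proof -
    have eq: "padic_char (- (x * \<xi>)) * cnj (\<phi> \<xi>) = cnj (padic_char (\<xi> * x) * \<phi> \<xi>)" for \<xi>
      by (simp add: padic_char_minus mult.commute)
    have "inv_fourier \<nu> (\<lambda>\<xi>. cnj (\<phi> \<xi>)) x = (\<integral>\<xi>. cnj (padic_char (\<xi> * x) * \<phi> \<xi>) \<partial>\<nu>)"
      unfolding inv_fourier_def[of \<nu> "\<lambda>\<xi>. cnj (\<phi> \<xi>)"] eq ..
    also have "\<dots> = cnj (\<integral>\<xi>. padic_char (\<xi> * x) * \<phi> \<xi> \<partial>\<nu>)" by (rule Bochner_Integration.integral_cnj)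
    finally show ?thesis by (simp add: fourier_inversion)
  qed
  then have "(\<integral>\<xi>. cnj (\<phi> \<xi>) * \<phi> \<xi> \<partial>\<nu>) = (\<integral>x. indicator E x * of_real (local_density x) \<partial>\<nu>)"
    using inv_fourier_multiplication[OF integrable_indicator_complex[OF E_fmeasurable] int] by simp
  also have "\<dots> = (\<integral>x. indicator E x \<partial>\<nu>)"
  proof (rule integral_cong_AE)
    have "indicator E x * complex_of_real (local_density x) = indicator (E \<inter> smooth_version) x" for x
      using local_density_0_or_1[of x] by (auto simp: indicator_def smooth_version_def)
    then have eq: "(\<lambda>x. indicator E x * complex_of_real (local_density x)) = indicator (E \<inter> smooth_version)"
      by auto
    show "(\<lambda>x. indicator E x * complex_of_real (local_density x)) \<in> borel_measurable \<nu>"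
      unfolding eq by (intro borel_measurable_indicator) (simp add: sets.Int)
    show "AE x in \<nu>. indicator E x * complex_of_real (local_density x) = indicator E x"
      using AE_smooth_version by eventually_elim (auto simp: smooth_version_def indicator_def)
  qed simp
  finally show ?thesis by (simp add: integral_indicator_complex mult.commute)
qed

text \<open>The ball of radius \<open>p ^ M\<close> consists of \<open>p ^ n\<close> balls of radius \<open>p ^ (- N)\<close>, and each of them lies in the
  set or outside it according to its centre. So the measure of the set counts centres.\<close>

lemma card_smooth_version:
  assumes sub: "smooth_version \<subseteq> padic_ball M 0" and n: "int n = M + N" and one: "measure \<nu> E = 1"
  shows "real (card {a. a < CARD('p) ^ n \<and> of_nat a * unif powi (- M) \<in> smooth_version})
    = real CARD('p) powi N"
proof -
  let ?B = "\<lambda>a. padic_ball (M - int n) (0 + of_nat a * unif powi (- M) :: 'p padic)"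
  let ?T = smooth_version
  have r: "M - int n = - N" using n by simp
  have "emeasure \<nu> E = ennreal (measure \<nu> E)"
    by (rule emeasure_eq_measure2[OF E_fmeasurable])
  then have "emeasure \<nu> E = 1" using one by simp
  then have "1 = emeasure \<nu> ?T"
    using AE_smooth_version by (subst emeasure_eq_AE[of ?T E]) auto
  also have "\<dots> = (\<Sum>a<CARD('p) ^ n. emeasure \<nu> (?T \<inter> ?B a))"
    using sub unfolding padic_ball_split[of M 0 n]
    by (intro sum_emeasure_cover disjoint_padic_subballs) auto
  also have "\<dots> = (\<Sum>a<CARD('p) ^ n.
      if of_nat a * unif powi (- M) \<in> ?T then ennreal (real CARD('p) powi (- N)) else 0)"
  proof (intro sum.cong refl)
    fix a
    let ?c = "of_nat a * unif powi (- M) :: 'p padic"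
    show "emeasure \<nu> (?T \<inter> ?B a) = (if ?c \<in> ?T then ennreal (real CARD('p) powi (- N)) else 0)"
    proof (cases "?c \<in> ?T")
      case True
      then have "?T \<inter> ?B a = ?B a" using padic_ball_subset_smooth_version[OF True] by (auto simp: r)
      then show ?thesis using True by (simp add: emeasure_padic_ball r)
    next
      case False
      have "x \<notin> ?T" if "x \<in> ?B a" for x
      proof -
        have "local_density x = local_density ?c"
          using that unfolding r add_0 by (rule local_density_cong)
        then show ?thesis using False by (simp add: smooth_version_def)
      qed
      then have "?T \<inter> ?B a = {}" by blast
      then show ?thesis using False by simp
    qed
  qed
  also have "\<dots> = (\<Sum>a\<in>{a. a < CARD('p) ^ n \<and> of_nat a * unif powi (- M) \<in> ?T}.
      ennreal (real CARD('p) powi (- N)))"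
    by (subst sum.inter_filter[symmetric]) (auto simp: lessThan_def)
  also have "\<dots> = ennreal (real (card {a. a < CARD('p) ^ n \<and> of_nat a * unif powi (- M) \<in> ?T})
      * real CARD('p) powi (- N))"
    by (simp add: ennreal_mult ennreal_of_nat_eq_real_of_nat)
  finally have "real (card {a. a < CARD('p) ^ n \<and> of_nat a * unif powi (- M) \<in> ?T})
      * real CARD('p) powi (- N) = 1"
    unfolding ennreal_eq_1[symmetric] by (rule sym)
  then show ?thesis by (simp add: power_int_minus field_simps)
qed

end

section \<open>Scaling sets\<close>

lemma scaling_function_norm:
  assumes "scaling_function \<mu> V \<phi>"
  shows "(\<integral>x. \<phi> x * cnj (\<phi> x) \<partial>\<mu>) = 1"
proof -
  have "\<forall>a\<in>padic_I. \<forall>b\<in>padic_I.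
      L2_inner \<mu> (\<lambda>x. \<phi> (x - a)) (\<lambda>x. \<phi> (x - b)) = (if a = b then 1 else 0)"
    using assms unfolding scaling_function_def L2_orthonormal_basis_def by blast
  from bspec[OF bspec[OF this zero_in_padic_I] zero_in_padic_I] show ?thesis
    by (simp add: L2_inner_def)
qed

lemma test_space_borel_measurable: "f \<in> test_space N M \<Longrightarrow> f \<in> borel_measurable borel"
  by (intro borel_measurable_continuous_onI continuous_on_locally_constant) (simp add: test_space_def)

text \<open>Two locally constant versions agree almost everywhere, and their agreement is a locally constant
  condition.\<close>

lemma (in borel_haar) locally_constant_version_unique:
  assumes T: "locally_constant_version (completion \<nu>) S T"
    and T': "locally_constant_version (completion \<nu>) S T'"
  shows "T = T'"
proof -
  have "locally_constant (\<lambda>x. x \<in> T \<longleftrightarrow> x \<in> T')"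
    unfolding locally_constant_def
  proof
    fix x
    obtain g where g: "\<And>y. y \<in> padic_ball g x \<Longrightarrow> (indicator T y :: complex) = indicator T x"
      using T unfolding locally_constant_version_def locally_constant_def by blast
    obtain g' where g': "\<And>y. y \<in> padic_ball g' x \<Longrightarrow> (indicator T' y :: complex) = indicator T' x"
      using T' unfolding locally_constant_version_def locally_constant_def by blast
    have "(y \<in> T \<longleftrightarrow> y \<in> T') \<longleftrightarrow> (x \<in> T \<longleftrightarrow> x \<in> T')" if "y \<in> padic_ball (min g g') x" for y
    proof -
      have "y \<in> padic_ball g x" "y \<in> padic_ball g' x"
        using that padic_ball_mono[of "min g g'" g x] padic_ball_mono[of "min g g'" g' x] by auto
      from g[OF this(1)] g'[OF this(2)] show ?thesis by (auto simp: indicator_def split: if_splits)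
    qed
    then show "\<exists>\<gamma>. \<forall>y\<in>padic_ball \<gamma> x. (y \<in> T \<longleftrightarrow> y \<in> T') \<longleftrightarrow> (x \<in> T \<longleftrightarrow> x \<in> T')" by blast
  qed
  moreover have "AE x in \<nu>. x \<in> T \<longleftrightarrow> x \<in> S" "AE x in \<nu>. x \<in> T' \<longleftrightarrow> x \<in> S"
    using T T' unfolding locally_constant_version_def AE_completion_iff by auto
  then have "AE x in \<nu>. x \<in> T \<longleftrightarrow> x \<in> T'" by eventually_elim auto
  ultimately have "x \<in> T \<longleftrightarrow> x \<in> T'" for x by (rule AE_locally_constant_imp)
  then show ?thesis by blast
qed

lemma (in borel_haar) inv_fourier_completion_cong:
  assumes S: "S \<in> sets (completion \<nu>)" and E: "E \<in> sets borel" and SE: "AE x in \<nu>. x \<in> E \<longleftrightarrow> x \<in> S"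
  shows "inv_fourier (completion \<nu>) (indicator S) = inv_fourier \<nu> (indicator E)"
proof
  fix \<xi>
  let ?\<mu> = "completion \<nu>"
  have char: "(\<lambda>x. padic_char (- (\<xi> * x))) \<in> borel_measurable \<nu>"
    using borel_measurable_padic_char_mult[of "- \<xi>"] by (simp add: mult.commute)
  have fE: "(\<lambda>x. padic_char (- (\<xi> * x)) * indicator E x) \<in> borel_measurable \<nu>"
    using char E by (intro borel_measurable_times borel_measurable_indicator) auto
  have "(\<integral>x. padic_char (- (\<xi> * x)) * indicator S x \<partial>?\<mu>)
      = (\<integral>x. padic_char (- (\<xi> * x)) * indicator E x \<partial>?\<mu>)"
  proof (rule integral_cong_AE)
    show "(\<lambda>x. padic_char (- (\<xi> * x)) * indicator S x) \<in> borel_measurable ?\<mu>"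
      using measurable_completion[OF char] S by (intro borel_measurable_times borel_measurable_indicator)
    show "(\<lambda>x. padic_char (- (\<xi> * x)) * indicator E x) \<in> borel_measurable ?\<mu>"
      by (rule measurable_completion[OF fE])
    show "AE x in ?\<mu>. padic_char (- (\<xi> * x)) * indicator S x = padic_char (- (\<xi> * x)) * indicator E x"
      unfolding AE_completion_iff using SE by eventually_elim (simp add: indicator_def)
  qed
  also have "\<dots> = (\<integral>x. padic_char (- (\<xi> * x)) * indicator E x \<partial>\<nu>)" by (rule integral_completion[OF fE])
  finally show "inv_fourier ?\<mu> (indicator S) \<xi> = inv_fourier \<nu> (indicator E) \<xi>"
    by (simp add: inv_fourier_def)
qed

lemma mem_padic_scale_iff:
  "x \<in> padic_scale M T \<longleftrightarrow> x * unif powi (- M) \<in> (T :: 'p::prime_card padic set)"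
proof
  assume "x * unif powi (- M) \<in> T"
  then have "unif powi M * (x * unif powi (- M)) \<in> padic_scale M T"
    unfolding padic_scale_def by (rule imageI)
  moreover have "unif powi M * (x * unif powi (- M)) = x"
    by (simp add: power_int_minus field_simps)
  ultimately show "x \<in> padic_scale M T" by (simp only:)
next
  assume "x \<in> padic_scale M T"
  then obtain a where "a \<in> T" "x = unif powi M * a" by (auto simp: padic_scale_def)
  moreover have "unif powi M * a * unif powi (- M) = a"
    by (simp add: power_int_minus field_simps)
  ultimately show "x * unif powi (- M) \<in> T" by (simp only:)
qed

theorem theorem3p14:
  fixes \<mu> :: "'p::prime_card padic measure" and S :: "'p padic set" and M N :: nat
  assumes "padic_haar \<mu>"
    and "inv_fourier \<mu> (indicator S) \<in> test_space (int N) (int M)"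
    and "scaling_set \<mu> S"
  shows "(\<exists>!T. locally_constant_version \<mu> S T) \<and>
    (\<forall>T. locally_constant_version \<mu> S T \<longrightarrow>
      card {n :: int. 0 \<le> n \<and> n \<le> int CARD('p) ^ (M + N) - 1 \<and>
        of_int n \<in> padic_scale (int M) T} = CARD('p) ^ N)"
proof -
  obtain \<nu> where \<nu>: "sets \<nu> = sets borel" "\<And>a. distr \<nu> borel ((+) a) = \<nu>"
    "emeasure \<nu> (padic_ball 0 0) = 1" and \<mu>: "\<mu> = completion \<nu>"
    using assms(1) unfolding padic_haar_def by blast
  interpret borel_haar \<nu> by unfold_locales (rule \<nu>)+
  define E where "E = main_part \<nu> S"
  have S: "S \<in> sets (completion \<nu>)" using assms(3) by (simp add: scaling_set_def \<mu>)
  then have E: "E \<in> sets borel" unfolding E_def using main_part_sets[of S \<nu>] by simp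
  have "AE x in \<nu>. x \<notin> null_part \<nu> S" by (rule AE_notin_null_part[OF S])
  then have SE: "AE x in \<nu>. x \<in> E \<longleftrightarrow> x \<in> S"
    by eventually_elim (use main_part_null_part_Un[OF S] in \<open>auto simp: E_def\<close>)
  let ?\<phi> = "inv_fourier \<nu> (indicator E)"
  have \<phi>: "inv_fourier \<mu> (indicator S) = ?\<phi>"
    unfolding \<mu> by (rule inv_fourier_completion_cong[OF S E SE])
  have test: "?\<phi> \<in> test_space (int N) (int M)" using assms(2) by (simp only: \<phi>)
  note meas = test_space_borel_measurable[OF test]
  have "integrable \<mu> (\<lambda>x. (norm (indicator S x :: complex))\<^sup>2)"
    using assms(3) by (simp add: scaling_set_def L2_def)
  also have "(\<lambda>x. (norm (indicator S x :: complex))\<^sup>2) = indicat_real S"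
    by (auto simp: indicator_def)
  finally have "emeasure \<mu> S < \<infinity>" using S by (simp add: \<mu> integrable_indicator_iff)
  then have "emeasure \<nu> E < \<infinity>" using S by (simp add: \<mu> E_def)
  then have Efm: "E \<in> fmeasurable \<nu>" using E by (intro fmeasurableI) auto
  interpret band_limited_set \<nu> E "int N"
    by unfold_locales (use Efm test in \<open>auto simp: test_space_def\<close>)

  obtain V where "scaling_function \<mu> V ?\<phi>" using assms(3) unfolding scaling_set_def \<phi> by blast
  then have "(\<integral>\<xi>. ?\<phi> \<xi> * cnj (?\<phi> \<xi>) \<partial>\<mu>) = 1" by (rule scaling_function_norm)
  moreover have "(\<integral>\<xi>. ?\<phi> \<xi> * cnj (?\<phi> \<xi>) \<partial>\<mu>) = (\<integral>\<xi>. ?\<phi> \<xi> * cnj (?\<phi> \<xi>) \<partial>\<nu>)"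
    unfolding \<mu> using meas borel_measurable_continuous_on[OF continuous_on_cnj[OF continuous_on_id] meas]
    by (intro integral_completion borel_measurable_times) auto
  ultimately have one: "measure \<nu> E = 1" using plancherel[OF meas] by simp
  have sub: "smooth_version \<subseteq> padic_ball (int M) 0"
    using test by (intro smooth_version_subset_ball meas) (simp add: test_space_def)

  have version: "locally_constant_version \<mu> S smooth_version"
    unfolding locally_constant_version_def \<mu> AE_completion_iff
  proof
    show "AE x in \<nu>. x \<in> smooth_version \<longleftrightarrow> x \<in> S"
      using AE_smooth_version SE by eventually_elim simp
  qed (rule locally_constant_smooth_version)
  have unique: "T = smooth_version" if "locally_constant_version \<mu> S T" for T
    using locally_constant_version_unique that version unfolding \<mu> by blast

  let ?A = "{a. a < CARD('p) ^ (M + N) \<and> of_nat a * unif powi (- int M) \<in> smooth_version}"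
  have "real (card ?A) = real CARD('p) powi int N"
    by (rule card_smooth_version[OF sub _ one]) simp
  then have "real (card ?A) = real (CARD('p) ^ N)" by simp
  then have cardA: "card ?A = CARD('p) ^ N" by (simp only: of_nat_eq_iff)
  have "{n :: int. 0 \<le> n \<and> n \<le> int CARD('p) ^ (M + N) - 1 \<and>
      of_int n \<in> padic_scale (int M) smooth_version} = int ` ?A" (is "?L = _")
  proof (intro equalityI subsetI)
    fix n assume n: "n \<in> ?L"
    then obtain a where a: "n = int a" using nonneg_int_cases by blast
    have "int a < int (CARD('p) ^ (M + N))" using n a by simp
    then have "a < CARD('p) ^ (M + N)" by (simp only: of_nat_less_iff)
    then show "n \<in> int ` ?A" using n by (simp add: a mem_padic_scale_iff)
  next
    fix n assume "n \<in> int ` ?A"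
    then obtain a where a: "n = int a" "a \<in> ?A" by blast
    then have "int a < int (CARD('p) ^ (M + N))" by (simp only: of_nat_less_iff mem_Collect_eq)
    then show "n \<in> ?L" using a by (simp add: mem_padic_scale_iff)
  qed
  then have "card ?L = CARD('p) ^ N" using cardA by (simp add: card_image)
  then show ?thesis using version unique by blast
qed

end
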